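(* Let $n\ge 2$ and $s\in[\tfrac12,1)$. Let $K\subset\mathbb{R}^n$ be a compact convex set which is smooth (of class at least $C^{0,1}$). Let $f\in C^1([0,1])$ be such that there exists $\theta\in(0,1)$ with $$f(0)=f(\theta)=f(1)=0,\quad f<0 \text{ in }(0,\theta),\quad f>0\text{ in }(\theta,1),$$ $$\int_0^1 f(t)\,dt>0,\quad f'(0)<0,\quad f'(\theta)>0,\quad f'(1)<0.$$ Let $\beta>2s-1$ and let $u\in C^{1,\beta}(\mathbb{R}^n\setminus K,[0,1])$ satisfy $$\mathcal{L}[u](x)+f(u(x))\le 0\quad\text{for all }x\in\mathbb{R}^n\setminus K,$$ $$\nabla u\cdot\nu=0\quad\text{on }\partial K,\qquad u(x)\to 1\ \text{ as }|x|\to+\infty,$$ where $\mathcal{L}$ is the regional $s$-fractional Laplacian on $\mathbb{R}^n\setminus K$ and $\nu$ is the outward unit normal to $K$ on $\partial K$. Then $u=1$ in $\overline{\mathbb{R}^n\setminus K}$.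
   Context: The regional fractional Laplacian on $\mathbb{R}^n\setminus K$ is defined, for $s\in(0,1)$, by $$\mathcal{L}[u](x):=C_{n,s}\lim_{\epsilon\to0^+}\int_{\{y\in\mathbb{R}^n\setminus K,\ |x-y|>\epsilon\}}\frac{u(y)-u(x)}{|x-y|^{n+2s}}\,dy,$$ where $C_{n,s}>0$ is the usual normalization constant of the fractional Laplacian. "Smooth (of class at least $C^{0,1}$)" means that the boundary of $K$ has at least Lipschitz regularity; the Neumann condition $\nabla u\cdot\nu=0$ is understood at the points of $\partial K$ where the outward unit normal $\nu$ exists. $C^{1,\beta}(\mathbb{R}^n\setminus K,[0,1])$ is the set of $[0,1]$-valued $C^1$ functions on $\mathbb{R}^n\setminus K$ which, together with their gradient, are bounded and whose gradient is (uniformly) Hölder continuous with exponent $\beta$; such a $u$ and its gradient $\nabla u$ are identified with their continuous extensions to the closure $\overline{\mathbb{R}^n\setminus K}$. *)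

theory Defs
  imports "HOL-Analysis.Analysis"
begin

text \<open>Constant of the operator written as a principal value of first differences
  \<open>u y - u x\<close>, in dimension \<open>n\<close>.\<close>

definition frac_laplacian_const :: "nat \<Rightarrow> real \<Rightarrow> real" where
  "frac_laplacian_const n s =
     4 powr s * Gamma (real n / 2 + s) / (pi powr (real n / 2) * \<bar>Gamma (- s)\<bar>)"

text \<open>Only the values of \<open>u\<close> on \<open>- K\<close> enter when \<open>x \<notin> K\<close>.\<close>

definition regional_frac_laplacian ::
    "'a::euclidean_space set \<Rightarrow> real \<Rightarrow> ('a \<Rightarrow> real) \<Rightarrow> 'a \<Rightarrow> real" where
  "regional_frac_laplacian K s u x =
     frac_laplacian_const DIM('a) s *
     Lim (at_right 0)
       (\<lambda>\<epsilon>. LINT y:{y. y \<notin> K \<and> norm (x - y) > \<epsilon>}|lborel.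
              (u y - u x) / norm (x - y) powr (real DIM('a) + 2 * s))"

text \<open>Near each boundary point, \<open>K\<close> is the subgraph of a Lipschitz function over a
  hyperplane \<open>{v. v \<bullet> e = 0}\<close>.\<close>

definition lipschitz_boundary :: "'a::euclidean_space set \<Rightarrow> bool" where
  "lipschitz_boundary K \<longleftrightarrow>
     (\<forall>p\<in>frontier K. \<exists>r>0. \<exists>e \<phi> L. norm e = 1 \<and> L-lipschitz_on {v. v \<bullet> e = 0} \<phi> \<and>
        K \<inter> ball p r = {x \<in> ball p r. x \<bullet> e \<le> \<phi> (x - (x \<bullet> e) *\<^sub>R e)})"

text \<open>To first order at \<open>p\<close>, \<open>K\<close> is the half-space \<open>{x. (x - p) \<bullet> \<nu> \<le> 0}\<close>. For a set with
  Lipschitz boundary this says that the local graph function is differentiable at the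
  boundary point and that \<open>\<nu>\<close> is the unit normal of the tangent hyperplane pointing out
  of \<open>K\<close>. There is at most one such \<open>\<nu>\<close>.\<close>

definition outward_unit_normal :: "'a::euclidean_space set \<Rightarrow> 'a \<Rightarrow> 'a \<Rightarrow> bool" where
  "outward_unit_normal K p \<nu> \<longleftrightarrow>
     p \<in> frontier K \<and> norm \<nu> = 1 \<and>
     (\<forall>\<eta>>0. \<exists>r>0. \<forall>x\<in>ball p r.
        ((x - p) \<bullet> \<nu> < - \<eta> * norm (x - p) \<longrightarrow> x \<in> K) \<and>
        ((x - p) \<bullet> \<nu> > \<eta> * norm (x - p) \<longrightarrow> x \<notin> K))"

text \<open>\<open>u\<close> is of class \<open>C\<^sup>1\<^sup>,\<^sup>\<beta>\<close> on the open set \<open>\<Omega>\<close> with gradient \<open>Du\<close>. On \<open>closure \<Omega>\<close> both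
  functions take the values of their continuous extensions; in particular \<open>Du\<close> is
  determined by \<open>u\<close> there.\<close>

definition C1_holder_on ::
    "'a::euclidean_space set \<Rightarrow> real \<Rightarrow> ('a \<Rightarrow> real) \<Rightarrow> ('a \<Rightarrow> 'a) \<Rightarrow> bool" where
  "C1_holder_on \<Omega> \<beta> u Du \<longleftrightarrow>
     (\<forall>x\<in>\<Omega>. GDERIV u x :> Du x) \<and>
     continuous_on (closure \<Omega>) u \<and> continuous_on (closure \<Omega>) Du \<and>
     bounded (u ` \<Omega>) \<and> bounded (Du ` \<Omega>) \<and>
     (\<exists>M. \<forall>x\<in>\<Omega>. \<forall>y\<in>\<Omega>. norm (Du x - Du y) \<le> M * norm (x - y) powr \<beta>)"

end

theory Submission
  imports Defs
begin

text \<open>Suppose \<open>m = inf u < 1\<close>. By convexity the distance \<open>d\<close> to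
  \<open>K\<close> satisfies \<open>d y \<ge> d x + (y - x) \<bullet> e\<close> for some unit vector
  \<open>e\<close> at every \<open>x \<notin> K\<close>. For a level \<open>v\<close> in \<open>(m,
  1)\<close> let \<open>x\<close> be a point farthest from \<open>K\<close> with \<open>u x \<le>
  v\<close>, and \<open>T v\<close> its distance to \<open>K\<close>; the inverse
  \<open>\<psi>\<close> of \<open>T\<close>, constant on negative arguments, is a nondecreasing
  function of one variable such that \<open>u y\<close> dominates the planar function \<open>\<psi>
  (T v + (y - x) \<bullet> e)\<close>, with equality at \<open>x\<close>. On \<open>K\<close> this
  planar function takes its minimum \<open>m\<close>, so each truncated operator applied to
  \<open>u\<close> at \<open>x\<close> is at least the same operator on the whole space applied to
  \<open>\<psi>\<close>, viewed as a function of one coordinate, at \<open>T v\<close>. The integral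
  of the latter over the levels \<open>v\<close>, that is against \<open>d\<psi>\<close>, vanishes
  because the kernel is even. It is bounded above by an integrable function of \<open>v\<close>:
  near \<open>0\<close> the profile \<open>\<psi>\<close> is only Lipschitz, but \<open>s <
  1\<close>. Fatou's lemma and the equation \<open>L u \<le> - f u\<close> then give
  \<open>\<integral>\<^bsub>m\<^esub>\<^bsup>1\<^esup> f \<le> 0\<close>, which is false for a
  bistable \<open>f\<close> of positive mean.\<close>

section \<open>Singular kernels and isometries\<close>

text \<open>On each annulus the power is comparable with \<open>r k powr q\<close> and the volume is
  a multiple of \<open>r k ^ DIM('a)\<close>, so the integral is dominated by the assumed convergent
  series.\<close>

lemma integrable_norm_powr_annuli:
  fixes E :: "'a::euclidean_space set" and q :: real
  assumes E [measurable]: "E \<in> sets borel"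
    and r: "\<And>k. r k > (0::real)"
    and sm: "summable (\<lambda>k. r k powr (q + DIM('a)))"
    and cov: "\<And>y. y \<in> E \<Longrightarrow> \<exists>k. r k < norm y \<and> norm y \<le> 2 * r k"
  shows "integrable lborel (\<lambda>y. indicator E y * norm y powr q)"
proof (rule integrableI_nonneg)
  \<comment> \<open>For \<open>q \<ge> 0\<close> the power is largest on the outer sphere, for
    \<open>q < 0\<close> on the inner one; \<open>C\<close> serves both signs.\<close>
  define C where "C = max 1 (2 powr q)"
  have C0: "C > 0" by (simp add: C_def)
  define D where "D = C * unit_ball_vol (DIM('a)) * 2 ^ DIM('a)"
  have D0: "D \<ge> 0" unfolding D_def using C0 by simp
  have bnd: "norm y powr q \<le> C * r k powr q" if "r k < norm y" "norm y \<le> 2 * r k" for y :: 'a and k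
  proof (cases "q \<ge> 0")
    case True
    have "norm y powr q \<le> (2 * r k) powr q" using that True by (intro powr_mono2) auto
    also have "\<dots> = 2 powr q * r k powr q" using r[of k] by (simp add: powr_mult)
    also have "\<dots> \<le> C * r k powr q" by (intro mult_right_mono) (auto simp: C_def)
    finally show ?thesis .
  next
    case False
    have "norm y powr q \<le> r k powr q" using that False r[of k] by (intro powr_mono2') auto
    also have "\<dots> \<le> C * r k powr q" using mult_right_mono[of 1 C "r k powr q"] by (auto simp: C_def)
    finally show ?thesis .
  qed
  have "(\<integral>\<^sup>+ y. ennreal (indicator E y * norm y powr q) \<partial>lborel)
      \<le> (\<integral>\<^sup>+ y. (\<Sum>k. ennreal (C * r k powr q) * indicator (cball 0 (2 * r k)) y) \<partial>(lborel :: 'a measure))"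
  proof (rule nn_integral_mono)
    fix y :: 'a
    show "ennreal (indicator E y * norm y powr q)
        \<le> (\<Sum>k. ennreal (C * r k powr q) * indicator (cball 0 (2 * r k)) y)"
    proof (cases "y \<in> E")
      case True
      then obtain k where k: "r k < norm y" "norm y \<le> 2 * r k" using cov by blast
      have "ennreal (indicator E y * norm y powr q) \<le> (\<Sum>k\<in>{k}. ennreal (C * r k powr q) * indicator (cball 0 (2 * r k)) y)"
        using bnd[OF k] k True by (simp add: ennreal_leI)
      also have "\<dots> \<le> (\<Sum>k. ennreal (C * r k powr q) * indicator (cball 0 (2 * r k)) y)"
        by (intro sum_le_suminf) auto
      finally show ?thesis .
    qed simp
  qed
  also have "\<dots> = (\<Sum>k. ennreal (C * r k powr q) * emeasure lborel (cball 0 (2 * r k) :: 'a set))"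
  proof (subst nn_integral_suminf)
    show "(\<Sum>k. \<integral>\<^sup>+ y. ennreal (C * r k powr q) * indicator (cball 0 (2 * r k) :: 'a set) y \<partial>lborel)
      = (\<Sum>k. ennreal (C * r k powr q) * emeasure lborel (cball 0 (2 * r k) :: 'a set))"
      by (intro suminf_cong nn_integral_cmult_indicator) simp
  qed (intro borel_measurable_times_ennreal borel_measurable_const borel_measurable_indicator, simp)
  also have "\<dots> = (\<Sum>k. ennreal (D * r k powr (q + DIM('a))))"
  proof (intro suminf_cong)
    fix k
    have "ennreal (C * r k powr q) * emeasure lborel (cball 0 (2 * r k) :: 'a set)
        = ennreal ((C * r k powr q) * (unit_ball_vol (DIM('a)) * (2 * r k) ^ DIM('a)))"
      using r[of k] C0 by (subst emeasure_cball, simp, subst ennreal_mult[symmetric]) auto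
    also have "(C * r k powr q) * (unit_ball_vol (DIM('a)) * (2 * r k) ^ DIM('a)) = D * r k powr (q + DIM('a))"
      using r[of k] unfolding D_def power_mult_distrib powr_add by (simp add: powr_realpow)
    finally show "ennreal (C * r k powr q) * emeasure lborel (cball 0 (2 * r k) :: 'a set)
       = ennreal (D * r k powr (q + DIM('a)))" .
  qed
  also have "\<dots> < \<infinity>"
    using D0 sm by (subst suminf_ennreal2) (auto intro: summable_mult)
  finally show "(\<integral>\<^sup>+ y. ennreal (indicator E y * norm y powr q) \<partial>lborel) < \<infinity>" .
qed auto

text \<open>Dyadic annuli shrinking to the origin reduce the criterion to a geometric series of
  ratio \<open>2 powr (- (q + DIM('a)))\<close>.\<close>

lemma integrable_norm_powr_cball:
  fixes q :: real
  assumes "q + DIM('a::euclidean_space) > 0"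
  shows "integrable lborel (\<lambda>y::'a. indicator (cball 0 1) y * norm y powr q)"
proof -
  define Q where "Q = q + DIM('a)"
  have Q: "Q > 0" using assms by (simp add: Q_def)
  have int: "integrable lborel (\<lambda>y::'a. indicator (cball 0 1 - {0}) y * norm y powr q)"
  proof (rule integrable_norm_powr_annuli[where r = "\<lambda>k. 2 powr (- (real k + 1))"])
    have "(\<lambda>k. (2 powr (- (real k + 1))) powr Q) = (\<lambda>k. 2 powr (-Q) * (2 powr (-Q)) ^ k)"
      by (auto simp: powr_powr powr_realpow[symmetric] powr_add[symmetric] algebra_simps)
    moreover have "summable (\<lambda>k. 2 powr (-Q) * (2 powr (-Q)) ^ k)"
      using Q by (intro summable_mult summable_geometric) (auto simp: powr_less_one)
    ultimately show "summable (\<lambda>k. (2 powr (- (real k + 1))) powr (q + DIM('a)))"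
      by (simp add: Q_def)
    fix y :: 'a assume y: "y \<in> cball 0 1 - {0}"
    define k where "k = nat \<lfloor>- log 2 (norm y)\<rfloor>"
    have n: "0 < norm y" "norm y \<le> 1" using y by auto
    then have "0 \<le> - log 2 (norm y)" by simp
    then have k: "real k \<le> - log 2 (norm y)" "- log 2 (norm y) < real k + 1"
      unfolding k_def by linarith+
    have e: "norm y = 2 powr (log 2 (norm y))" using n by simp
    have "2 powr (- (real k + 1)) < norm y" by (subst e) (use k in simp)
    moreover have "norm y \<le> 2 powr (- real k)" by (subst e) (use k in simp)
    moreover have "2 * 2 powr (- (real k + 1)) = 2 powr (- real k)"
      by (simp add: powr_diff powr_minus)
    ultimately show "\<exists>k. 2 powr (- (real k + 1)) < norm y \<and> norm y \<le> 2 * 2 powr (- (real k + 1))"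
      by metis
  qed auto
  \<comment> \<open>The annuli miss the origin; putting it back changes nothing because
    \<open>0 powr q = 0\<close>.\<close>
  have "(\<lambda>y::'a. indicator (cball 0 1 - {0}) y * norm y powr q) = (\<lambda>y. indicator (cball 0 1) y * norm y powr q)"
    by (auto simp: indicator_def fun_eq_iff)
  with int show ?thesis by simp
qed

text \<open>The same with dyadic annuli growing outward from radius \<open>\<delta>\<close>; the
  ratio is now \<open>2 powr (q + DIM('a))\<close>.\<close>

lemma integrable_norm_powr_exterior:
  fixes q \<delta> :: real
  assumes "q + DIM('a::euclidean_space) < 0" "\<delta> > 0"
  shows "integrable lborel (\<lambda>y::'a. indicator {y. \<delta> < norm y} y * norm y powr q)"
proof (rule integrable_norm_powr_annuli[where r = "\<lambda>k. \<delta> * 2 ^ k"])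
  define Q where "Q = q + DIM('a)"
  have Q: "Q < 0" using assms by (simp add: Q_def)
  have "(\<lambda>k. (\<delta> * 2 ^ k) powr Q) = (\<lambda>k. \<delta> powr Q * (2 powr Q) ^ k)"
    using \<open>\<delta> > 0\<close> by (auto simp: powr_powr powr_realpow[symmetric] powr_mult algebra_simps)
  moreover have "summable (\<lambda>k. \<delta> powr Q * (2 powr Q) ^ k)"
    using Q by (intro summable_mult summable_geometric) (auto simp: powr_less_one)
  ultimately show "summable (\<lambda>k. (\<delta> * 2 ^ k) powr (q + DIM('a)))"
    by (simp add: Q_def)
  fix y :: 'a assume "y \<in> {y. \<delta> < norm y}"
  then have y: "\<delta> < norm y" by simp
  define l where "l = log 2 (norm y / \<delta>)"
  \<comment> \<open>Ceiling minus one rather than floor: the annuli are open inside and closed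
    outside, so \<open>k < l \<le> k + 1\<close> is required.\<close>
  define k where "k = nat (\<lceil>l\<rceil> - 1)"
  have "1 < norm y / \<delta>" using y assms by simp
  then have "0 < l" unfolding l_def by (subst zero_less_log_cancel_iff) auto
  then have k: "real k < l" "l \<le> real k + 1"
    unfolding k_def by linarith+
  have "2 powr l = norm y / \<delta>" unfolding l_def using \<open>1 < norm y / \<delta>\<close> by (subst powr_log_cancel) auto
  then have e: "norm y = \<delta> * 2 powr l" using assms by simp
  have "2 ^ k = 2 powr real k" "2 ^ Suc k = 2 powr (real k + 1)"
    by (simp_all add: powr_realpow powr_add)
  then have "\<delta> * 2 ^ k < norm y \<and> norm y \<le> \<delta> * 2 ^ Suc k" using k e assms by simp
  then show "\<exists>k. \<delta> * 2 ^ k < norm y \<and> norm y \<le> 2 * (\<delta> * 2 ^ k)"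
    by (metis mult.left_commute power_Suc)
qed (use assms in auto)

text \<open>Double counting: translating the unit ball over \<open>f \<circ> R\<close> and over \<open>f\<close>
  gives the same double integral.\<close>

lemma lborel_distr_isometry:
  fixes R :: "'a::euclidean_space \<Rightarrow> 'a"
  assumes lin: "linear R" and nrm: "\<And>x. norm (R x) = norm x" and surj: "surj R"
  shows "distr lborel borel R = lborel"
proof (rule measure_eqI)
  fix A :: "'a set" assume "A \<in> sets (distr lborel borel R)"
  then have A [measurable]: "A \<in> sets borel" by simp
  have Rm [measurable]: "R \<in> borel_measurable borel"
    by (intro borel_measurable_continuous_onI linear_continuous_on linear_conv_bounded_linear[THEN iffD1] lin)
  define b :: "'a \<Rightarrow> ennreal" where "b y = indicator {y. norm y < 1} y" for y
  have [measurable]: "b \<in> borel_measurable borel" unfolding b_def by measurable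
  define V where "V = (\<integral>\<^sup>+y. b y \<partial>lborel)"
  have bz: "(\<integral>\<^sup>+x. b (z - x) \<partial>lborel) = emeasure lborel (ball z 1)" for z
  proof -
    have "b (z - x) = indicator (ball z 1) x" for x by (simp add: b_def indicator_def dist_norm)
    then show ?thesis by simp
  qed
  have tr: "(\<integral>\<^sup>+x. g (c + x) \<partial>lborel) = (\<integral>\<^sup>+x. g x \<partial>lborel)"
    if [measurable]: "g \<in> borel_measurable borel" for g :: "'a \<Rightarrow> ennreal" and c :: 'a
  proof -
    have "(\<integral>\<^sup>+x. g x \<partial>lborel) = (\<integral>\<^sup>+x. g x \<partial>distr lborel borel ((+) c))"
      by (simp add: lborel_distr_plus)
    also have "\<dots> = (\<integral>\<^sup>+x. g (c + x) \<partial>lborel)"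
      by (subst nn_integral_distr) auto
    finally show ?thesis by simp
  qed
  have Ve: "V = emeasure lborel (ball 0 1 :: 'a set)"
    using bz[of 0] by (simp add: V_def b_def indicator_def)
  have V: "V \<noteq> 0" "V < \<infinity>"
    unfolding Ve using emeasure_lborel_ball_finite[of "0::'a" 1]
    by (simp_all add: emeasure_ball less_imp_neq[OF unit_ball_vol_pos, symmetric])
  have eR: "emeasure (distr lborel borel R) A = (\<integral>\<^sup>+x. indicator A (R x) \<partial>lborel)"
    by (subst nn_integral_indicator[symmetric], simp, subst nn_integral_distr) auto
  have "V * emeasure (distr lborel borel R) A = (\<integral>\<^sup>+y. b y * (\<integral>\<^sup>+x. indicator A (R x) \<partial>lborel) \<partial>lborel)"
    by (subst nn_integral_multc) (simp_all add: eR V_def)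
  \<comment> \<open>Translating \<open>x\<close> by a preimage of \<open>y\<close> turns
    \<open>R x\<close> into \<open>R x + y\<close>.\<close>
  also have "\<dots> = (\<integral>\<^sup>+y. b y * (\<integral>\<^sup>+x. indicator A (R x + y) \<partial>lborel) \<partial>lborel)"
  proof (rule nn_integral_cong, rule arg_cong2[where f = "(*)", OF refl])
    fix y :: 'a
    obtain z where z: "R z = y" using surj by (metis surjD)
    have "(\<integral>\<^sup>+x. indicator A (R x) \<partial>lborel) = ((\<integral>\<^sup>+x. indicator A (R (z + x)) \<partial>lborel) :: ennreal)"
      by (rule tr[of "\<lambda>x. indicator A (R x)" z, symmetric]) measurable
    then show "(\<integral>\<^sup>+x. indicator A (R x) \<partial>lborel) = ((\<integral>\<^sup>+x. indicator A (R x + y) \<partial>lborel) :: ennreal)"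
      by (simp add: linear_add[OF lin] z add.commute)
  qed
  also have "\<dots> = (\<integral>\<^sup>+y. (\<integral>\<^sup>+x. b y * indicator A (R x + y) \<partial>lborel) \<partial>lborel)"
    by (subst nn_integral_cmult) auto
  also have "\<dots> = (\<integral>\<^sup>+x. (\<integral>\<^sup>+y. b y * indicator A (R x + y) \<partial>lborel) \<partial>lborel)"
    by (rule lborel_pair.Fubini') measurable
  \<comment> \<open>Translating \<open>y\<close> by \<open>R x\<close> frees \<open>A\<close> of
    \<open>x\<close>; the integral in \<open>x\<close> is then the volume of a unit ball around a
    preimage of \<open>y\<close>, that is \<open>V\<close> again.\<close>
  also have "\<dots> = (\<integral>\<^sup>+x. (\<integral>\<^sup>+y. b (y - R x) * indicator A y \<partial>lborel) \<partial>lborel)"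
  proof (rule nn_integral_cong)
    fix x :: 'a
    have "(\<integral>\<^sup>+y. b (R x + y - R x) * indicator A (R x + y) \<partial>lborel)
        = (\<integral>\<^sup>+y. b (y - R x) * indicator A y \<partial>lborel)"
      by (rule tr) measurable
    then show "(\<integral>\<^sup>+y. b y * indicator A (R x + y) \<partial>lborel) = (\<integral>\<^sup>+y. b (y - R x) * indicator A y \<partial>lborel)"
      by simp
  qed
  also have "\<dots> = (\<integral>\<^sup>+y. (\<integral>\<^sup>+x. b (y - R x) * indicator A y \<partial>lborel) \<partial>lborel)"
    by (rule lborel_pair.Fubini') measurable
  also have "\<dots> = (\<integral>\<^sup>+y. V * indicator A y \<partial>lborel)"
  proof (rule nn_integral_cong)
    fix y :: 'a
    obtain z where z: "R z = y" using surj by (metis surjD)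
    have "b (y - R x) = b (z - x)" for x
      using nrm[of "z - x"] by (simp add: linear_diff[OF lin] z b_def indicator_def)
    then have "(\<integral>\<^sup>+x. b (y - R x) * indicator A y \<partial>lborel) = (\<integral>\<^sup>+x. b (z - x) * indicator A y \<partial>lborel)"
      by simp
    also have "\<dots> = emeasure lborel (ball z 1) * indicator A y"
      by (subst nn_integral_multc) (auto simp: bz)
    also have "\<dots> = V * indicator A y"
      by (simp add: Ve emeasure_ball)
    finally show "(\<integral>\<^sup>+x. b (y - R x) * indicator A y \<partial>lborel) = V * indicator A y" .
  qed
  also have "\<dots> = V * emeasure lborel A"
    by (subst nn_integral_cmult_indicator) auto
  finally have *: "V * emeasure (distr lborel borel R) A = V * emeasure lborel A" .
  show "emeasure (distr lborel borel R) A = emeasure lborel A"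
    using * V by (metis ennreal_mult_cancel_left less_irrefl infinity_ennreal_def)
qed simp

text \<open>The reflection in the hyperplane orthogonal to \<open>e - e1\<close> exchanges
  \<open>e\<close> and \<open>e1\<close>.\<close>

lemma exists_isometry:
  fixes e e1 :: "'a::euclidean_space"
  assumes "norm e = 1" "norm e1 = 1"
  obtains R where "linear R" "\<And>x. norm (R x) = norm x" "surj R" "\<And>x. R x \<bullet> e1 = x \<bullet> e"
proof
  define w where "w = e - e1"
  \<comment> \<open>For \<open>e = e1\<close> division by zero gives \<open>c = 0\<close>, and
    \<open>R\<close> is the identity.\<close>
  define c where "c = 2 / (w \<bullet> w)"
  define R where "R x = x - (c * (x \<bullet> w)) *\<^sub>R w" for x
  have c: "c * (c * (w \<bullet> w)) = 2 * c" by (simp add: c_def)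
  show "linear R"
    by (rule linearI) (simp_all add: R_def inner_add_left ring_distribs scaleR_diff_right scaleR_add_left mult.left_commute)
  have e: "e \<bullet> e = 1" "e1 \<bullet> e1 = 1" using assms by (simp_all add: norm_eq_1)
  have RR: "R (R x) = x" for x
  proof -
    have "c * (R x \<bullet> w) = c * (x \<bullet> w) - c * (c * (w \<bullet> w)) * (x \<bullet> w)"
      by (simp add: R_def inner_diff_left right_diff_distrib mult_ac)
    then have "c * (R x \<bullet> w) = - (c * (x \<bullet> w))" unfolding c by simp
    moreover have "R (R x) = R x - (c * (R x \<bullet> w)) *\<^sub>R w" by (rule R_def)
    moreover have "R x = x - (c * (x \<bullet> w)) *\<^sub>R w" by (rule R_def)
    ultimately show ?thesis by simp
  qed
  have "(R x) \<bullet> (R x) = x \<bullet> x" for x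
  proof -
    have "(R x) \<bullet> (R x) = x \<bullet> x - 2 * c * (x \<bullet> w)\<^sup>2 + (c * (c * (w \<bullet> w))) * (x \<bullet> w)\<^sup>2"
      by (simp add: R_def inner_diff_left inner_diff_right inner_commute ring_distribs power2_eq_square mult_ac)
    then show ?thesis unfolding c by simp
  qed
  then show "norm (R x) = norm x" for x by (simp add: norm_eq_sqrt_inner)
  show "surj R" using RR by (metis surjI)
  show "R x \<bullet> e1 = x \<bullet> e" for x
  proof (cases "w = 0")
    case True then show ?thesis by (simp add: R_def w_def)
  next
    case False
    have *: "w \<bullet> w = - 2 * (w \<bullet> e1)"
      using e by (simp add: w_def inner_diff_left inner_diff_right inner_commute)
    have "w \<bullet> w \<noteq> 0" using False by simp
    then have "c * (w \<bullet> e1) = - 1" using * by (simp add: c_def field_simps)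
    then have "c * (x \<bullet> w) * (w \<bullet> e1) = - (x \<bullet> w)"
      by (metis mult.commute mult.left_commute mult_minus1)
    moreover have "R x \<bullet> e1 = x \<bullet> e1 - c * (x \<bullet> w) * (w \<bullet> e1)" by (simp add: R_def inner_diff_left)
    moreover have "x \<bullet> w = x \<bullet> e - x \<bullet> e1" by (simp add: w_def inner_diff_right)
    ultimately show ?thesis by simp
  qed
qed

text \<open>Serves to replace the direction attached to each farthest point by one direction common
  to all levels, so that the levels can be integrated.\<close>

lemma lborel_integral_inner_rotate:
  fixes e e1 :: "'a::euclidean_space" and h :: "real \<Rightarrow> real \<Rightarrow> real"
  assumes "norm e = 1" "norm e1 = 1"
    and [measurable]: "case_prod h \<in> borel_measurable (borel \<Otimes>\<^sub>M borel)"
  shows "(\<integral>y. h (norm y) (y \<bullet> e) \<partial>lborel) = (\<integral>y. h (norm y) (y \<bullet> e1) \<partial>lborel)"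
proof -
  obtain R where R: "linear R" "\<And>x. norm (R x) = norm x" "surj R" "\<And>x. R x \<bullet> e1 = x \<bullet> e"
    using exists_isometry[OF assms(1,2)] by metis
  have [measurable]: "R \<in> borel_measurable borel"
    by (intro borel_measurable_continuous_onI linear_continuous_on linear_conv_bounded_linear[THEN iffD1] R)
  have "(\<integral>y. h (norm y) (y \<bullet> e1) \<partial>lborel) = (\<integral>y. h (norm y) (y \<bullet> e1) \<partial>distr lborel borel R)"
    by (simp add: lborel_distr_isometry[OF R(1-3)])
  also have "\<dots> = (\<integral>y. h (norm y) (y \<bullet> e) \<partial>lborel)"
    by (subst integral_distr) (auto simp: R)
  finally show ?thesis by simp
qed

section \<open>Truncated principal values\<close>

lemma lborel_integral_translate:
  fixes g :: "'a::euclidean_space \<Rightarrow> real"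
  assumes [measurable]: "g \<in> borel_measurable borel"
  shows "(\<integral>y. g (c + y) \<partial>lborel) = (\<integral>y. g y \<partial>lborel)"
proof -
  have "(\<integral>y. g y \<partial>lborel) = (\<integral>y. g y \<partial>distr lborel borel ((+) c))"
    by (simp add: lborel_distr_plus)
  also have "\<dots> = (\<integral>y. g (c + y) \<partial>lborel)"
    by (subst integral_distr) auto
  finally show ?thesis by simp
qed

lemma lborel_integral_reflect:
  fixes g :: "'a::euclidean_space \<Rightarrow> real"
  assumes [measurable]: "g \<in> borel_measurable borel"
  shows "(\<integral>y. g (- y) \<partial>lborel) = (\<integral>y. g y \<partial>lborel)"
proof -
  have "(\<integral>y. g y \<partial>lborel) = (\<integral>y. g y \<partial>distr lborel borel uminus)"
    using lborel_distr_isometry[of "uminus :: 'a \<Rightarrow> 'a"] surj_uminus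
    by (simp add: linear_uminus)
  also have "\<dots> = (\<integral>y. g (- y) \<partial>lborel)"
    by (subst integral_distr) auto
  finally show ?thesis by simp
qed

section \<open>Taylor estimates for a Hoelder continuous gradient\<close>

lemma gderiv_mean_value:
  fixes u :: "'a::euclidean_space \<Rightarrow> real"
  assumes "\<And>\<tau>. \<lbrakk>0 \<le> \<tau>; \<tau> \<le> 1\<rbrakk> \<Longrightarrow> GDERIV u (x + \<tau> *\<^sub>R z) :> Du (x + \<tau> *\<^sub>R z)"
  obtains \<xi> where "0 < \<xi>" "\<xi> < 1" "u (x + z) - u x = z \<bullet> Du (x + \<xi> *\<^sub>R z)"
proof -
  have "\<exists>\<xi>>0. \<xi> < 1 \<and> u (x + 1 *\<^sub>R z) - u (x + 0 *\<^sub>R z) = (1 - 0) * (z \<bullet> Du (x + \<xi> *\<^sub>R z))"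
  proof (rule MVT2)
    fix \<tau> :: real assume \<tau>: "0 \<le> \<tau>" "\<tau> \<le> 1"
    have "((\<lambda>\<tau>. u (x + \<tau> *\<^sub>R z)) has_derivative (\<lambda>h. (h *\<^sub>R z) \<bullet> Du (x + \<tau> *\<^sub>R z))) (at \<tau>)"
      by (rule has_derivative_compose[where g = u and f = "\<lambda>\<tau>. x + \<tau> *\<^sub>R z"])
        (use assms[OF \<tau>] in \<open>auto simp: gderiv_def intro!: derivative_eq_intros\<close>)
    moreover have "(\<lambda>h. (h *\<^sub>R z) \<bullet> Du (x + \<tau> *\<^sub>R z)) = (*) (z \<bullet> Du (x + \<tau> *\<^sub>R z))"
      by (auto simp: mult.commute)
    ultimately show "((\<lambda>\<tau>. u (x + \<tau> *\<^sub>R z)) has_real_derivative z \<bullet> Du (x + \<tau> *\<^sub>R z)) (at \<tau>)"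
      by (simp add: has_field_derivative_def)
  qed simp
  then show ?thesis using that by auto
qed

lemma gderiv_lipschitz_bound:
  fixes u :: "'a::euclidean_space \<Rightarrow> real"
  assumes "\<And>\<tau>. \<lbrakk>0 \<le> \<tau>; \<tau> \<le> 1\<rbrakk> \<Longrightarrow> x + \<tau> *\<^sub>R z \<in> S"
    and "\<And>w. w \<in> S \<Longrightarrow> GDERIV u w :> Du w" and B: "\<And>w. w \<in> S \<Longrightarrow> norm (Du w) \<le> B"
  shows "u (x + z) \<le> u x + B * norm z"
proof -
  obtain \<xi> where \<xi>: "0 < \<xi>" "\<xi> < 1" "u (x + z) - u x = z \<bullet> Du (x + \<xi> *\<^sub>R z)"
    using gderiv_mean_value[of u x z Du] assms by blast
  have "z \<bullet> Du (x + \<xi> *\<^sub>R z) \<le> norm z * norm (Du (x + \<xi> *\<^sub>R z))" by (rule norm_cauchy_schwarz)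
  also have "\<dots> \<le> norm z * B" using \<xi> assms(1) by (intro mult_left_mono B) auto
  finally show ?thesis using \<xi> by (simp add: mult.commute)
qed

lemma gderiv_holder_bound:
  fixes u :: "'a::euclidean_space \<Rightarrow> real"
  assumes S: "\<And>\<tau>. \<lbrakk>0 \<le> \<tau>; \<tau> \<le> 1\<rbrakk> \<Longrightarrow> x + \<tau> *\<^sub>R z \<in> S"
    and D: "\<And>w. w \<in> S \<Longrightarrow> GDERIV u w :> Du w"
    and M: "\<And>w w'. \<lbrakk>w \<in> S; w' \<in> S\<rbrakk> \<Longrightarrow> norm (Du w - Du w') \<le> M * norm (w - w') powr \<beta>"
    and "0 \<le> M" "0 \<le> \<beta>"
  shows "\<bar>u (x + z) - u x - z \<bullet> Du x\<bar> \<le> M * norm z powr (1 + \<beta>)"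
proof -
  obtain \<xi> where \<xi>: "0 < \<xi>" "\<xi> < 1" "u (x + z) - u x = z \<bullet> Du (x + \<xi> *\<^sub>R z)"
    using gderiv_mean_value[of u x z Du] S D by blast
  have "\<bar>u (x + z) - u x - z \<bullet> Du x\<bar> = \<bar>z \<bullet> (Du (x + \<xi> *\<^sub>R z) - Du x)\<bar>"
    using \<xi> by (simp add: inner_diff_right)
  also have "\<dots> \<le> norm z * norm (Du (x + \<xi> *\<^sub>R z) - Du x)" by (rule Cauchy_Schwarz_ineq2)
  also have "\<dots> \<le> norm z * (M * norm (x + \<xi> *\<^sub>R z - x) powr \<beta>)"
    using M[of "x + \<xi> *\<^sub>R z" x] S[of \<xi>] S[of 0] \<xi> by (intro mult_left_mono) auto
  also have "\<dots> \<le> norm z * (M * norm z powr \<beta>)"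
    using assms(4,5) \<xi> by (intro mult_left_mono powr_mono2) (auto intro: mult_left_le_one_le)
  also have "\<dots> = M * norm z powr (1 + \<beta>)"
    by (cases "z = 0") (simp_all add: powr_add)
  finally show ?thesis .
qed

text \<open>The linear terms of the expansions at \<open>z\<close> and \<open>- z\<close> cancel, so
  only the two Hoelder remainders are left.\<close>

lemma gderiv_second_difference_bound:
  fixes u :: "'a::euclidean_space \<Rightarrow> real"
  assumes S: "\<And>\<tau>. \<bar>\<tau>\<bar> \<le> 1 \<Longrightarrow> x + \<tau> *\<^sub>R z \<in> S"
    and D: "\<And>w. w \<in> S \<Longrightarrow> GDERIV u w :> Du w"
    and M: "\<And>w w'. \<lbrakk>w \<in> S; w' \<in> S\<rbrakk> \<Longrightarrow> norm (Du w - Du w') \<le> M * norm (w - w') powr \<beta>"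
    and nn: "0 \<le> M" "0 \<le> \<beta>"
  shows "\<bar>u (x + z) + u (x - z) - 2 * u x\<bar> \<le> 2 * M * norm z powr (1 + \<beta>)"
proof -
  have "\<bar>u (x + z) - u x - z \<bullet> Du x\<bar> \<le> M * norm z powr (1 + \<beta>)"
    by (rule gderiv_holder_bound[where S = S]) (use S D M nn in auto)
  moreover have "\<bar>u (x + - z) - u x - - z \<bullet> Du x\<bar> \<le> M * norm (- z) powr (1 + \<beta>)"
  proof (rule gderiv_holder_bound[where S = S])
    show "x + \<tau> *\<^sub>R - z \<in> S" if "0 \<le> \<tau>" "\<tau> \<le> 1" for \<tau>
      using S[of "- \<tau>"] that by simp
  qed (use D M nn in auto)
  ultimately show ?thesis by (simp add: abs_le_iff)
qed

section \<open>Kernels cut off around the singularity\<close>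

definition trunc_kernel :: "real \<Rightarrow> real \<Rightarrow> 'a::euclidean_space \<Rightarrow> real" where
  "trunc_kernel p \<delta> y = indicator {y. \<delta> < norm y} y * norm y powr (- p)"

lemma trunc_kernel_measurable [measurable]: "trunc_kernel p \<delta> \<in> borel_measurable borel"
  unfolding trunc_kernel_def by measurable

lemma trunc_kernel_nonneg [simp]: "0 \<le> trunc_kernel p \<delta> y"
  by (simp add: trunc_kernel_def)

lemma trunc_kernel_minus [simp]: "trunc_kernel p \<delta> (- y) = trunc_kernel p \<delta> y"
  by (simp add: trunc_kernel_def indicator_def)

lemma integrable_trunc_kernel:
  assumes "real DIM('a::euclidean_space) < p" "0 < \<delta>"
  shows "integrable lborel (trunc_kernel p \<delta> :: 'a \<Rightarrow> real)"
  unfolding trunc_kernel_def using assms by (intro integrable_norm_powr_exterior) auto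

lemma integrable_bounded_mult:
  fixes k h :: "'b \<Rightarrow> real"
  assumes "integrable N k" "h \<in> borel_measurable N" "\<And>x. \<bar>h x\<bar> \<le> c"
  shows "integrable N (\<lambda>x. k x * h x)"
proof (rule Bochner_Integration.integrable_bound[where f = "\<lambda>x. c * k x"])
  show "AE x in N. norm (k x * h x) \<le> norm (c * k x)"
    using assms(3) by (auto simp: abs_mult mult.commute intro!: AE_I2 mult_right_mono order_trans[OF assms(3)])
qed (use assms in auto)

text \<open>The kernel is even, so the odd part of \<open>F\<close> integrates to zero.\<close>

lemma symmetrized_trunc_integral:
  fixes F :: "'a::euclidean_space \<Rightarrow> real"
  assumes p: "real DIM('a) < p" "0 < \<delta>" and [measurable]: "F \<in> borel_measurable borel" and F: "\<And>y. \<bar>F y\<bar> \<le> c"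
  shows "(\<integral>y. trunc_kernel p \<delta> y * F y \<partial>lborel)
    = (\<integral>y. trunc_kernel p \<delta> y * ((F y + F (- y)) / 2) \<partial>lborel)"
proof -
  have i1: "integrable lborel (\<lambda>y. trunc_kernel p \<delta> y * F y)"
    by (intro integrable_bounded_mult integrable_trunc_kernel p) (use F in auto)
  have i2: "integrable lborel (\<lambda>y. trunc_kernel p \<delta> y * F (- y))"
    by (intro integrable_bounded_mult integrable_trunc_kernel p) (use F in auto)
  have e: "(\<integral>y. trunc_kernel p \<delta> y * F (- y) \<partial>lborel) = (\<integral>y. trunc_kernel p \<delta> y * F y \<partial>lborel)"
    using lborel_integral_reflect[of "\<lambda>y. trunc_kernel p \<delta> y * F y"] by simp
  have "(\<integral>y. trunc_kernel p \<delta> y * ((F y + F (- y)) / 2) \<partial>lborel)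
    = (\<integral>y. (trunc_kernel p \<delta> y * F y) / 2 + (trunc_kernel p \<delta> y * F (- y)) / 2 \<partial>lborel)"
    by (intro Bochner_Integration.integral_cong) (auto simp: field_simps)
  also have "\<dots> = (\<integral>y. (trunc_kernel p \<delta> y * F y) \<partial>lborel) / 2 + (\<integral>y. (trunc_kernel p \<delta> y * F (- y)) \<partial>lborel) / 2"
    using i1 i2 by (subst Bochner_Integration.integral_add) auto
  finally show ?thesis using e by simp
qed

text \<open>Moves the regional integral to the origin and to the whole space, the increment being
  zero outside \<open>\<Omega>\<close>; this makes it comparable with whole-space operators.\<close>

lemma set_lebesgue_integral_trunc_kernel:
  fixes u :: "'a::euclidean_space \<Rightarrow> real"
  assumes [measurable]: "(\<lambda>y. indicator \<Omega> y * u y) \<in> borel_measurable borel" "\<Omega> \<in> sets borel"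
  shows "(LINT y:{y. y \<in> \<Omega> \<and> norm (x - y) > \<delta>}|lborel. (u y - c) / norm (x - y) powr p)
    = (\<integral>y. trunc_kernel p \<delta> y * (indicator \<Omega> (x + y) * (u (x + y) - c)) \<partial>lborel)"
proof -
  \<comment> \<open>The product is expanded so that \<open>u\<close> enters only through
    \<open>indicator \<Omega> y * u y\<close>, the function known to be measurable.\<close>
  define G where "G y = trunc_kernel p \<delta> (y - x) * (indicator \<Omega> y * u y - c * indicator \<Omega> y)" for y
  have [measurable]: "G \<in> borel_measurable borel" unfolding G_def by measurable
  have "(LINT y:{y. y \<in> \<Omega> \<and> norm (x - y) > \<delta>}|lborel. (u y - c) / norm (x - y) powr p) = (\<integral>y. G y \<partial>lborel)"
    unfolding set_lebesgue_integral_def G_def trunc_kernel_def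
    by (intro Bochner_Integration.integral_cong)
      (auto simp: indicator_def norm_minus_commute powr_minus divide_inverse)
  also have "\<dots> = (\<integral>y. G (x + y) \<partial>lborel)" by (rule lborel_integral_translate[symmetric]) measurable
  also have "\<dots> = (\<integral>y. trunc_kernel p \<delta> y * (indicator \<Omega> (x + y) * (u (x + y) - c)) \<partial>lborel)"
    unfolding G_def by (intro Bochner_Integration.integral_cong) (auto simp: right_diff_distrib)
  finally show ?thesis .
qed

text \<open>Dominated convergence after symmetrization: near the origin the even part is of order
  \<open>norm y powr q\<close>, and \<open>q - p\<close> exceeds the threshold
  \<open>- DIM('a)\<close>; farther out \<open>F\<close> is bounded and the kernel
  integrable.\<close>

lemma trunc_integral_converges:
  fixes F :: "'a::euclidean_space \<Rightarrow> real" and p q M c \<rho> :: real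
  assumes p: "real DIM('a) < p" and [measurable]: "F \<in> borel_measurable borel" and F: "\<And>y. \<bar>F y\<bar> \<le> c"
    and \<rho>: "0 < \<rho>" "\<rho> \<le> 1" and q: "p < q + DIM('a)"
    and M: "\<And>y. norm y < \<rho> \<Longrightarrow> \<bar>F y + F (- y)\<bar> \<le> M * norm y powr q"
  shows "\<exists>L. ((\<lambda>\<delta>. \<integral>y. trunc_kernel p \<delta> y * F y \<partial>lborel) \<longlongrightarrow> L) (at_right 0)"
proof -
  define H where "H y = (F y + F (- y)) / 2" for y
  have [measurable]: "H \<in> borel_measurable borel" unfolding H_def by measurable
  have Hc: "\<bar>H y\<bar> \<le> c" for y
    using F[of y] F[of "- y"] abs_triangle_ineq[of "F y" "F (- y)"] unfolding H_def abs_divide by simp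
  \<comment> \<open>A majorant independent of \<open>\<delta>\<close>. The radius
    \<open>\<rho> / 2\<close> lets the strict cutoff retain all points with
    \<open>\<rho> \<le> norm y\<close>.\<close>
  define w where "w y = \<bar>M\<bar> / 2 * (indicator (cball 0 1) y * norm y powr (q - p)) + c * trunc_kernel p (\<rho> / 2) y" for y :: 'a
  have w: "integrable lborel w"
    unfolding w_def using p \<rho> q
    by (intro Bochner_Integration.integrable_add integrable_mult_right integrable_norm_powr_cball integrable_trunc_kernel) auto
  have bound: "\<bar>trunc_kernel p \<delta> y * H y\<bar> \<le> w y" for \<delta> y
  proof -
    have c0: "0 \<le> c" using F[of 0] by linarith
    show ?thesis
    proof (cases "norm y < \<rho>")
      case True
      have "\<bar>H y\<bar> \<le> M / 2 * norm y powr q" using M[OF True] unfolding H_def abs_divide by simp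
      also have "\<dots> \<le> \<bar>M\<bar> / 2 * norm y powr q" by (intro mult_right_mono) auto
      finally have *: "\<bar>H y\<bar> \<le> \<bar>M\<bar> / 2 * norm y powr q" .
      have "\<bar>trunc_kernel p \<delta> y * H y\<bar> = trunc_kernel p \<delta> y * \<bar>H y\<bar>" by (simp add: abs_mult)
      also have "\<dots> \<le> norm y powr (- p) * (\<bar>M\<bar> / 2 * norm y powr q)"
        using * by (intro mult_mono) (auto simp: trunc_kernel_def indicator_def)
      also have "\<dots> = \<bar>M\<bar> / 2 * norm y powr (q - p)"
        using powr_add[of "norm y" "- p" q] by simp
      also have "\<dots> \<le> w y" unfolding w_def using True \<rho> mult_nonneg_nonneg[OF c0 trunc_kernel_nonneg] by simp
      finally show ?thesis .
    next
      case False
      have "\<bar>trunc_kernel p \<delta> y * H y\<bar> = trunc_kernel p \<delta> y * \<bar>H y\<bar>" by (simp add: abs_mult)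
      also have "\<dots> \<le> norm y powr (- p) * c"
        using Hc by (intro mult_mono) (auto simp: trunc_kernel_def indicator_def)
      also have "\<dots> = c * trunc_kernel p (\<rho> / 2) y"
        using False \<rho> by (auto simp: trunc_kernel_def indicator_def)
      also have "\<dots> \<le> w y" unfolding w_def by simp
      finally show ?thesis .
    qed
  qed
  have "((\<lambda>\<delta>. \<integral>y. trunc_kernel p \<delta> y * F y \<partial>lborel) \<longlongrightarrow> (\<integral>y. norm y powr (- p) * H y \<partial>lborel)) (at_right 0)"
  proof (rule tendsto_at_right_sequentially[of 0 1])
    fix S :: "nat \<Rightarrow> real"
    assume S: "\<And>n. 0 < S n" "S \<longlonglongrightarrow> 0"
    have "(\<lambda>n. \<integral>y. trunc_kernel p (S n) y * H y \<partial>lborel) \<longlonglongrightarrow> (\<integral>y. norm y powr (- p) * H y \<partial>lborel)"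
    proof (rule integral_dominated_convergence[OF _ _ w])
      show "AE y in lborel. (\<lambda>n. trunc_kernel p (S n) y * H y) \<longlonglongrightarrow> norm y powr (- p) * H y"
      proof (rule AE_I2)
        fix y :: 'a
        show "(\<lambda>n. trunc_kernel p (S n) y * H y) \<longlonglongrightarrow> norm y powr (- p) * H y"
        proof (cases "y = 0")
          case False
          then have "\<forall>\<^sub>F n in sequentially. S n < norm y"
            using S(2) by (intro order_tendstoD) auto
          then have "\<forall>\<^sub>F n in sequentially. trunc_kernel p (S n) y * H y = norm y powr (- p) * H y"
            by eventually_elim (simp add: trunc_kernel_def)
          then show ?thesis by (rule tendsto_eventually)
        qed (simp add: trunc_kernel_def)
      qed
      show "AE y in lborel. norm (trunc_kernel p (S n) y * H y) \<le> w y" for n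
        using bound by simp
    qed measurable
    moreover have "(\<integral>y. trunc_kernel p (S n) y * F y \<partial>lborel) = (\<integral>y. trunc_kernel p (S n) y * H y \<partial>lborel)" for n
      unfolding H_def by (rule symmetrized_trunc_integral[OF p S(1) assms(2) F])
    ultimately show "(\<lambda>n. \<integral>y. trunc_kernel p (S n) y * F y \<partial>lborel) \<longlonglongrightarrow> (\<integral>y. norm y powr (- p) * H y \<partial>lborel)"
      by simp
  qed simp
  then show ?thesis by blast
qed

text \<open>Fatou's lemma for the nonnegative functions \<open>g - a n\<close>: their integrals all
  equal that of \<open>g\<close>, and their lower limit is at least \<open>g - L\<close>, hence at
  least \<open>g - h\<close>. Since \<open>l\<close> and \<open>L\<close> enter only through
  pointwise comparisons, they may depend on a choice made at each point.\<close>

lemma Fatou_integral_bound: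
  fixes a l :: "nat \<Rightarrow> 'b \<Rightarrow> real"
  assumes a: "\<And>n. integrable N (a n)" "\<And>n. integral\<^sup>L N (a n) = 0"
    and al: "\<And>n x. x \<in> space N \<Longrightarrow> a n x \<le> l n x"
    and l: "\<And>x. x \<in> space N \<Longrightarrow> (\<lambda>n. l n x) \<longlonglongrightarrow> L x"
    and g: "integrable N g" "\<And>n x. x \<in> space N \<Longrightarrow> a n x \<le> g x"
    and h: "integrable N h" "\<And>x. x \<in> space N \<Longrightarrow> L x \<le> h x"
  shows "0 \<le> integral\<^sup>L N h"
proof -
  note [measurable] = borel_measurable_integrable[OF a(1)] borel_measurable_integrable[OF g(1)]
    borel_measurable_integrable[OF h(1)]
  have "ennreal (integral\<^sup>L N (\<lambda>x. g x - h x)) \<le> (\<integral>\<^sup>+x. ennreal (g x - h x) \<partial>N)"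
  proof -
    have i: "integrable N (\<lambda>x. g x - h x)" using g h by auto
    have "integral\<^sup>L N (\<lambda>x. g x - h x) \<le> integral\<^sup>L N (\<lambda>x. max 0 (g x - h x))"
      using i by (intro integral_mono) auto
    then have "ennreal (integral\<^sup>L N (\<lambda>x. g x - h x)) \<le> ennreal (integral\<^sup>L N (\<lambda>x. max 0 (g x - h x)))"
      by (rule ennreal_leI)
    also have "\<dots> = (\<integral>\<^sup>+x. ennreal (max 0 (g x - h x)) \<partial>N)"
      using i by (intro nn_integral_eq_integral[symmetric]) auto
    also have "\<dots> = (\<integral>\<^sup>+x. ennreal (g x - h x) \<partial>N)"
      by (intro nn_integral_cong) (simp add: max_def ennreal_neg)
    finally show ?thesis .
  qed
  also have "\<dots> \<le> (\<integral>\<^sup>+x. liminf (\<lambda>n. ennreal (g x - a n x)) \<partial>N)"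
  proof (rule nn_integral_mono)
    fix x assume x: "x \<in> space N"
    have "(\<lambda>n. ennreal (g x - l n x)) \<longlonglongrightarrow> ennreal (g x - L x)"
      by (intro tendsto_intros l x)
    then have "ennreal (g x - L x) = liminf (\<lambda>n. ennreal (g x - l n x))"
      by (simp add: lim_imp_Liminf)
    also have "\<dots> \<le> liminf (\<lambda>n. ennreal (g x - a n x))"
      by (intro Liminf_mono always_eventually allI ennreal_leI diff_left_mono al x)
    finally show "ennreal (g x - h x) \<le> liminf (\<lambda>n. ennreal (g x - a n x))"
      using h(2)[OF x] by (meson diff_left_mono ennreal_leI order_trans)
  qed
  also have "\<dots> \<le> liminf (\<lambda>n. \<integral>\<^sup>+x. ennreal (g x - a n x) \<partial>N)"
    by (intro nn_integral_liminf) measurable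
  also have "(\<lambda>n. \<integral>\<^sup>+x. ennreal (g x - a n x) \<partial>N) = (\<lambda>n. ennreal (integral\<^sup>L N g))"
  proof
    fix n
    have "(\<integral>\<^sup>+x. ennreal (g x - a n x) \<partial>N) = ennreal (integral\<^sup>L N (\<lambda>x. g x - a n x))"
      using g a(1)[of n] by (intro nn_integral_eq_integral) auto
    also have "integral\<^sup>L N (\<lambda>x. g x - a n x) = integral\<^sup>L N g"
      using g(1) a(1)[of n] a(2)[of n] by (subst Bochner_Integration.integral_diff) auto
    finally show "(\<integral>\<^sup>+x. ennreal (g x - a n x) \<partial>N) = ennreal (integral\<^sup>L N g)" .
  qed
  finally have "ennreal (integral\<^sup>L N (\<lambda>x. g x - h x)) \<le> ennreal (integral\<^sup>L N g)"
    by (simp add: Liminf_const)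
  \<comment> \<open>The comparison in \<open>ennreal\<close> carries over to the reals only if its
    right-hand side is nonnegative.\<close>
  moreover have "0 \<le> integral\<^sup>L N g"
    using integral_mono[OF a(1) g(1) g(2)] a(2) by simp
  ultimately have "integral\<^sup>L N (\<lambda>x. g x - h x) \<le> integral\<^sup>L N g" by simp
  then show ?thesis using g h by simp
qed

text \<open>After symmetrization \<open>near\<close> is used for \<open>norm y < t\<close>,
  \<open>far\<close> for \<open>t \<le> norm y \<le> 1\<close>, and the bound on \<open>h\<close>
  beyond. The result is uniform in \<open>\<delta>\<close> and grows only like
  \<open>t powr (- s)\<close> as \<open>t\<close> shrinks.\<close>

lemma trunc_integral_upper_bound:
  fixes e :: "'a::euclidean_space" and h :: "real \<Rightarrow> real" and s p t B M \<beta> \<delta> :: real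
  assumes e: "norm e = 1" and s: "0 < s" "s < 1" and p: "p = DIM('a) + 2 * s"
    and [measurable]: "h \<in> borel_measurable borel" and h: "\<And>z. \<bar>h z\<bar> \<le> 1"
    and \<beta>: "2 * s - 1 < \<beta>" "0 < 1 + \<beta>" and "0 \<le> M" "0 \<le> B" "0 < t" "0 < \<delta>"
    and near: "\<And>z. \<lbrakk>0 \<le> z; z < t\<rbrakk> \<Longrightarrow> h z + h (- z) \<le> 2 * M * z powr (1 + \<beta>)"
    and far: "\<And>z. 0 \<le> z \<Longrightarrow> h z + h (- z) \<le> B * z"
  shows "(\<integral>y. trunc_kernel p \<delta> y * h (y \<bullet> e) \<partial>lborel) \<le>
      M * (\<integral>y. indicator (cball 0 1) y * norm y powr (1 + \<beta> - p) \<partial>(lborel :: 'a measure))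
      + B * (\<integral>y. indicator (cball 0 1) y * norm y powr (1 - s - DIM('a)) \<partial>(lborel :: 'a measure)) * t powr (- s)
      + (\<integral>y. trunc_kernel p 1 y \<partial>(lborel :: 'a measure))"
proof -
  define n where "n = real DIM('a)"
  have pn: "n < p" using s p by (simp add: n_def)
  define g1 where "g1 y = indicator (cball 0 1) y * norm y powr (1 + \<beta> - p)" for y :: 'a
  define g2 where "g2 y = indicator (cball 0 1) y * norm y powr (1 - s - n)" for y :: 'a
  have g1: "integrable lborel g1" unfolding g1_def
    using \<beta> p by (intro integrable_norm_powr_cball) simp
  have g2: "integrable lborel g2" unfolding g2_def
    using s by (intro integrable_norm_powr_cball) (simp add: n_def)
  have g3: "integrable lborel (trunc_kernel p 1 :: 'a \<Rightarrow> real)"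
    using pn by (intro integrable_trunc_kernel) (simp_all add: n_def)
  have g0: "0 \<le> g1 y" "0 \<le> g2 y" for y by (simp_all add: g1_def g2_def)
  have nonneg: "0 \<le> M * g1 y" "0 \<le> B * g2 y * t powr (- s)" for y
    using g0[of y] \<open>0 \<le> M\<close> \<open>0 \<le> B\<close> by auto
  define H where "H y = (h (y \<bullet> e) + h (- y \<bullet> e)) / 2" for y
  have H2: "H y = (h \<bar>y \<bullet> e\<bar> + h (- \<bar>y \<bullet> e\<bar>)) / 2" for y
    by (simp add: H_def abs_if)
  have ye: "\<bar>y \<bullet> e\<bar> \<le> norm y" for y
    using Cauchy_Schwarz_ineq2[of y e] e by simp
  have pt: "trunc_kernel p \<delta> y * H y \<le> M * g1 y + B * g2 y * t powr (- s) + trunc_kernel p 1 y" for y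
  proof -
    consider "y = 0" | "1 < norm y" | "y \<noteq> 0" "norm y \<le> 1" "norm y < t" | "y \<noteq> 0" "norm y \<le> 1" "t \<le> norm y"
      by linarith
    then show ?thesis
    proof cases
      case 1
      then show ?thesis using nonneg[of y] \<open>0 < \<delta>\<close> by (simp add: trunc_kernel_def)
    next
      case 2
      have "H y \<le> 1" using h[of "\<bar>y \<bullet> e\<bar>"] h[of "- \<bar>y \<bullet> e\<bar>"] unfolding H2 abs_le_iff by simp
      then have "trunc_kernel p \<delta> y * H y \<le> trunc_kernel p \<delta> y * 1" by (intro mult_left_mono) auto
      also have "\<dots> \<le> trunc_kernel p 1 y" using 2 by (auto simp: trunc_kernel_def indicator_def)
      finally show ?thesis using nonneg[of y] by linarith
    next
      case 3
      have "H y \<le> M * \<bar>y \<bullet> e\<bar> powr (1 + \<beta>)"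
        using near[of "\<bar>y \<bullet> e\<bar>"] ye[of y] 3 unfolding H2 by simp
      also have "\<dots> \<le> M * norm y powr (1 + \<beta>)"
        using \<beta> \<open>0 \<le> M\<close> ye[of y] by (intro mult_left_mono powr_mono2) auto
      finally have "trunc_kernel p \<delta> y * H y \<le> trunc_kernel p \<delta> y * (M * norm y powr (1 + \<beta>))"
        by (intro mult_left_mono) auto
      also have "\<dots> \<le> norm y powr (- p) * (M * norm y powr (1 + \<beta>))"
        using \<open>0 \<le> M\<close> by (intro mult_right_mono) (auto simp: trunc_kernel_def indicator_def)
      also have "\<dots> = M * g1 y"
        using 3 powr_add[of "norm y" "- p" "1 + \<beta>"] by (simp add: g1_def)
      finally show ?thesis using nonneg[of y] trunc_kernel_nonneg[of p 1 y] by linarith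
    next
      case 4
      have "2 * H y \<le> B * \<bar>y \<bullet> e\<bar>"
        using far[of "\<bar>y \<bullet> e\<bar>"] unfolding H2 by simp
      also have "\<dots> \<le> B * norm y"
        using \<open>0 \<le> B\<close> ye[of y] by (intro mult_left_mono) auto
      finally have "H y \<le> B * norm y" using \<open>0 \<le> B\<close> mult_nonneg_nonneg[OF \<open>0 \<le> B\<close> norm_ge_zero[of y]] by linarith
      then have "trunc_kernel p \<delta> y * H y \<le> trunc_kernel p \<delta> y * (B * norm y)"
        by (intro mult_left_mono) auto
      also have "\<dots> \<le> norm y powr (- p) * (B * norm y)"
        using \<open>0 \<le> B\<close> by (intro mult_right_mono) (auto simp: trunc_kernel_def indicator_def)
      \<comment> \<open>The exponent \<open>1 - p\<close> splits as
        \<open>(1 - s - n) + (- s)\<close>: the first power is integrable at the origin since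
        \<open>s < 1\<close>, the second is at most \<open>t powr (- s)\<close> here.\<close>
      also have "\<dots> = B * g2 y * norm y powr (- s)"
      proof -
        have "norm y powr (- p) * norm y = norm y powr (- p + 1)"
          using 4 powr_add[of "norm y" "- p" 1] by simp
        also have "- p + 1 = (1 - s - n) + (- s)" by (simp add: p n_def)
        finally have "norm y powr (- p) * norm y = norm y powr (1 - s - n) * norm y powr (- s)"
          by (simp only: powr_add)
        then show ?thesis using 4 by (simp add: g2_def mult_ac)
      qed
      also have "\<dots> \<le> B * g2 y * t powr (- s)"
        using g0[of y] 4 \<open>0 < t\<close> \<open>0 \<le> B\<close> s by (intro mult_left_mono powr_mono2') auto
      finally show ?thesis using nonneg[of y] trunc_kernel_nonneg[of p 1 y] by linarith
    qed
  qed
  have Hb: "\<bar>H y\<bar> \<le> 1" for y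
    using h[of "y \<bullet> e"] h[of "- y \<bullet> e"] abs_triangle_ineq[of "h (y \<bullet> e)" "h (- y \<bullet> e)"]
    unfolding H_def abs_divide by simp
  have pd: "real DIM('a) < p" using pn by (simp add: n_def)
  have "(\<integral>y. trunc_kernel p \<delta> y * h (y \<bullet> e) \<partial>lborel) = (\<integral>y. trunc_kernel p \<delta> y * H y \<partial>lborel)"
    unfolding H_def by (rule symmetrized_trunc_integral[OF pd \<open>0 < \<delta>\<close>, of _ 1]) (use h in auto)
  also have "\<dots> \<le> (\<integral>y. M * g1 y + B * g2 y * t powr (- s) + trunc_kernel p 1 y \<partial>lborel)"
  proof (rule integral_mono)
    show "integrable lborel (\<lambda>y. trunc_kernel p \<delta> y * H y)"
      by (rule integrable_bounded_mult[OF integrable_trunc_kernel[OF pd \<open>0 < \<delta>\<close>] _ Hb])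
        (unfold H_def, measurable)
    show "integrable lborel (\<lambda>y. M * g1 y + B * g2 y * t powr (- s) + trunc_kernel p 1 y)"
      by (intro Bochner_Integration.integrable_add integrable_mult_right integrable_mult_left g1 g2 g3)
  qed (rule pt)
  also have "\<dots> = M * integral\<^sup>L lborel g1 + B * integral\<^sup>L lborel g2 * t powr (- s) + integral\<^sup>L lborel (trunc_kernel p 1 :: 'a \<Rightarrow> real)"
    using g1 g2 g3 by simp
  finally show ?thesis unfolding g1_def[abs_def] g2_def[abs_def] n_def .
qed

text \<open>Both integrals measure sets of pairs of levels \<open>(v, w)\<close>; exchanging \<open>v\<close> and \<open>w\<close> turns
  a shift by \<open>z\<close> into a shift by \<open>- z\<close>.\<close>

lemma profile_shift_antisymmetric:
  fixes T :: "real \<Rightarrow> real" and m :: real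
  assumes T: "strict_mono_on {m<..<1} T" and m: "m < 1"
  defines "N \<equiv> restrict_space lborel {m<..<1}"
  defines "\<psi> \<equiv> \<lambda>t. m + measure N {w \<in> space N. T w < t}"
  shows "(\<integral>v. \<psi> (T v + z) - v \<partial>N) + (\<integral>v. \<psi> (T v - z) - v \<partial>N) = 0"
proof -
  let ?J = "{m<..<1::real}"
  have spN: "space N = ?J" by (simp add: N_def space_restrict_space)
  have Tm [measurable]: "T \<in> borel_measurable N"
    using borel_measurable_mono_on_fnc[of ?J T] strict_mono_on_imp_mono_on[OF T]
    by (simp add: N_def cong: measurable_cong_sets)
  have eJ: "emeasure N (space N) = ennreal (1 - m)"
    using m by (simp add: spN) (simp add: N_def emeasure_restrict_space)
  have Nsp: "measure N (space N) = 1 - m" using m eJ by (simp add: measure_def)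
  interpret N: finite_measure N
    by (rule finite_measureI) (simp add: eJ)
  interpret NN: pair_sigma_finite N N ..
  interpret NNf: finite_measure "N \<Otimes>\<^sub>M N"
    by (rule finite_measure_pair_measure) (rule N.finite_measure_axioms)+
  \<comment> \<open>The integral of \<open>D z v w\<close> over \<open>w\<close> is
    \<open>\<psi> (T v + z) - m\<close>, which makes the claim one about pairs of levels.\<close>
  define D where "D z v w = (if T w < T v + z then 1 else 0 :: real)" for z v w
  have Dint: "integrable (N \<Otimes>\<^sub>M N) (\<lambda>(v, w). D z v w)" for z
    unfolding D_def by (rule NNf.integrable_const_bound[where B = 1]) auto
  have \<psi>: "\<psi> (T v + z) = m + (\<integral>w. D z v w \<partial>N)" for v z
  proof -
    have "(\<integral>w. D z v w \<partial>N) = (\<integral>w. indicator {w \<in> space N. T w < T v + z} w \<partial>N)"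
      by (intro Bochner_Integration.integral_cong) (auto simp: D_def)
    then show ?thesis by (simp add: \<psi>_def Int_absorb2)
  qed
  define P where "P z = (\<integral>v. (\<integral>w. D z v w \<partial>N) \<partial>N)" for z
  have Pint: "integrable N (\<lambda>v. \<integral>w. D z v w \<partial>N)" for z
    using NN.integrable_fst[OF Dint] by simp
  have vint: "integrable N (\<lambda>v. v)"
  proof (rule N.integrable_const_bound[where B = "\<bar>m\<bar> + 1"])
    show "(\<lambda>v. v) \<in> borel_measurable N" unfolding N_def by (rule measurable_restrict_space1) simp
  qed (auto simp: spN intro!: AE_I2)
  have vI: "(\<integral>v. v \<partial>N) = (1 - m\<^sup>2) / 2"
  proof -
    have "(\<integral>v. v \<partial>N) = (LBINT v:{m<..<1}. v)"
      by (simp add: N_def integral_restrict_space set_lebesgue_integral_def)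
    also have "\<dots> = (LBINT v=ereal m..ereal 1. v)"
      using m by (subst interval_integral_Ioo) auto
    also have "\<dots> = 1\<^sup>2 / 2 - m\<^sup>2 / 2"
      by (rule interval_integral_FTC_finite)
        (auto intro!: derivative_eq_intros continuous_intros simp: has_real_derivative_iff_has_vector_derivative[symmetric])
    finally show ?thesis by (simp add: field_simps)
  qed
  have Q: "(\<integral>v. \<psi> (T v + z) - v \<partial>N) = m * (1 - m) + P z - (1 - m\<^sup>2) / 2" for z
    unfolding \<psi> P_def using Pint[of z] vint Nsp vI by (simp add: mult.commute)
  \<comment> \<open>Fubini exchanges the two levels in \<open>P (- z)\<close>, so that it can be
    added to \<open>P z\<close> under the integral over \<open>v\<close>.\<close>
  have "P (- z) = (\<integral>v. (\<integral>w. D (- z) w v \<partial>N) \<partial>N)"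
    unfolding P_def using NN.Fubini_integral[OF Dint[of "- z"]] by simp
  moreover have "integrable N (\<lambda>v. \<integral>w. D (- z) w v \<partial>N)"
    using NN.integrable_snd[OF Dint[of "- z"]] by simp
  ultimately have "P z + P (- z) = (\<integral>v. (\<integral>w. D z v w \<partial>N) + (\<integral>w. D (- z) w v \<partial>N) \<partial>N)"
    using Pint[of z] by (simp only: P_def Bochner_Integration.integral_add)
  moreover have "(\<integral>w. D z v w \<partial>N) + (\<integral>w. D (- z) w v \<partial>N) = 1 - m" for v
  proof -
    have i: "integrable N (\<lambda>w. D z v w)" "integrable N (\<lambda>w. D (- z) w v)"
      unfolding D_def by (auto intro!: N.integrable_const_bound[where B = 1])
    \<comment> \<open>Exactly one of the two indicators is 1 unless \<open>T w = T v + z\<close>,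
      and strict monotonicity of \<open>T\<close> leaves at most one such \<open>w\<close>.\<close>
    have "AE w in N. T w \<noteq> T v + z"
    proof -
      have "{w \<in> space N. T w = T v + z} \<in> null_sets N"
      proof (cases "\<exists>w\<in>space N. T w = T v + z")
        case True
        then obtain w where w: "w \<in> space N" "T w = T v + z" by blast
        then have "{w \<in> space N. T w = T v + z} = {w}"
          using strict_mono_on_imp_inj_on[OF T] by (auto simp: spN inj_on_def)
        moreover have "{w} \<in> null_sets N"
          using w by (auto simp: N_def null_sets_restrict_space space_restrict_space)
        ultimately show ?thesis by simp
      next
        case False
        then have "{w \<in> space N. T w = T v + z} = {}" by blast
        then show ?thesis by (simp only: null_sets.empty_sets)
      qed
      then show ?thesis by (rule AE_I') auto
    qed
    then have "AE w in N. D z v w + D (- z) w v = 1"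
      by eventually_elim (auto simp: D_def)
    then have "(\<integral>w. D z v w + D (- z) w v \<partial>N) = (\<integral>w. 1 \<partial>N)"
      by (intro integral_cong_AE) (auto simp: D_def)
    then show ?thesis using i Nsp by simp
  qed
  ultimately have "P z + P (- z) = (\<integral>v. 1 - m \<partial>N)" by simp
  then have "P z + P (- z) = (1 - m) * (1 - m)" using Nsp by simp
  then show ?thesis using Q[of z] Q[of "- z"] by (simp add: algebra_simps power2_eq_square diff_divide_distrib)
qed

section \<open>Farthest points of sublevel sets\<close>

text \<open>By Fubini the levels are integrated first; this gives, by
  \<open>profile_shift_antisymmetric\<close>, an odd function of \<open>y \<bullet> e\<close>, whose
  integral against the even kernel vanishes.\<close>

lemma trunc_profile_integral_zero:
  fixes T :: "real \<Rightarrow> real" and m p \<delta> :: real and e :: "'a::euclidean_space"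
  assumes T: "strict_mono_on {m<..<1} T" and m: "0 \<le> m" "m < 1" and p: "real DIM('a) < p" "0 < \<delta>"
  defines "N \<equiv> restrict_space lborel {m<..<1}"
  defines "\<psi> \<equiv> \<lambda>t. m + measure N {w \<in> space N. T w < t}"
  defines "a \<equiv> \<lambda>v. \<integral>y. trunc_kernel p \<delta> y * (\<psi> (T v + y \<bullet> e) - v) \<partial>lborel"
  shows "integrable N a" "integral\<^sup>L N a = 0"
proof -
  let ?J = "{m<..<1::real}"
  have spN: "space N = ?J" by (simp add: N_def space_restrict_space)
  have Tm [measurable]: "T \<in> borel_measurable N"
    using borel_measurable_mono_on_fnc[of ?J T] strict_mono_on_imp_mono_on[OF T]
    by (simp add: N_def cong: measurable_cong_sets)
  have idm [measurable]: "(\<lambda>v. v) \<in> borel_measurable N" unfolding N_def by (rule measurable_restrict_space1) simp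
  have eJ: "emeasure N (space N) = ennreal (1 - m)"
    using m by (simp add: spN) (simp add: N_def emeasure_restrict_space)
  have Nsp: "measure N (space N) = 1 - m" using m eJ by (simp add: measure_def)
  interpret N: finite_measure N
    by (rule finite_measureI) (simp add: eJ)
  interpret NL: pair_sigma_finite N "lborel :: 'a measure" ..
  have "mono \<psi>"
    unfolding \<psi>_def by (intro monoI add_left_mono N.finite_measure_mono) auto
  then have [measurable]: "\<psi> \<in> borel_measurable borel" by (rule borel_measurable_mono)
  have \<psi>: "m \<le> \<psi> t" "\<psi> t \<le> 1" for t
    unfolding \<psi>_def using N.bounded_measure[of "{w \<in> space N. T w < t}"] Nsp by auto
  define k where "k = (trunc_kernel p \<delta> :: 'a \<Rightarrow> real)"
  have [measurable]: "k \<in> borel_measurable borel" by (simp add: k_def)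
  have k: "integrable lborel k" unfolding k_def by (rule integrable_trunc_kernel[OF p])
  define f where "f v y = k y * (\<psi> (T v + y \<bullet> e) - v)" for v y
  have [measurable]: "(\<lambda>(v, y). f v y) \<in> borel_measurable (N \<Otimes>\<^sub>M lborel)"
    unfolding f_def by measurable
  have fm: "f v \<in> borel_measurable lborel" for v unfolding f_def by measurable
  have fb: "norm (f v y) \<le> k y" if "v \<in> space N" for v y
  proof -
    have "\<bar>\<psi> (T v + y \<bullet> e) - v\<bar> \<le> 1" using \<psi>[of "T v + y \<bullet> e"] that m by (auto simp: spN)
    then have "\<bar>k y * (\<psi> (T v + y \<bullet> e) - v)\<bar> \<le> k y * 1"
      unfolding abs_mult by (intro mult_mono) (auto simp: k_def)
    then show ?thesis by (simp add: f_def)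
  qed
  have fi: "integrable lborel (f v)" if v: "v \<in> space N" for v
    by (rule Bochner_Integration.integrable_bound[OF k]) (use fb[OF v] fm in \<open>auto simp: k_def\<close>)
  have f: "integrable (N \<Otimes>\<^sub>M lborel) (\<lambda>(v, y). f v y)"
  proof (rule NL.Fubini_integrable)
    show "integrable N (\<lambda>v. \<integral>y. norm (case (v, y) of (v, y) \<Rightarrow> f v y) \<partial>lborel)"
    proof (rule N.integrable_const_bound[where B = "integral\<^sup>L lborel k"])
      show "AE v in N. norm (\<integral>y. norm (case (v, y) of (v, y) \<Rightarrow> f v y) \<partial>lborel) \<le> integral\<^sup>L lborel k"
        using fb fi k by (intro AE_I2) (auto intro!: integral_mono)
    qed measurable
    show "AE v in N. integrable lborel (\<lambda>y. case (v, y) of (v, y) \<Rightarrow> f v y)"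
      using fi by (intro AE_I2) auto
  qed measurable
  have a: "a = (\<lambda>v. \<integral>y. f v y \<partial>lborel)" by (simp add: a_def f_def k_def)
  show "integrable N a" unfolding a using NL.integrable_fst[OF f] by simp
  define G where "G z = (\<integral>v. \<psi> (T v + z) - v \<partial>N)" for z
  have "integral\<^sup>L N a = (\<integral>y. (\<integral>v. f v y \<partial>N) \<partial>lborel)"
    unfolding a using NL.Fubini_integral[OF f] by simp
  also have "\<dots> = (\<integral>y. k y * G (y \<bullet> e) \<partial>lborel)"
    by (simp add: f_def G_def)
  finally have 1: "integral\<^sup>L N a = (\<integral>y. k y * G (y \<bullet> e) \<partial>lborel)" .
  have Gm [measurable]: "G \<in> borel_measurable borel" unfolding G_def by measurable
  have 2: "(\<integral>y. k y * G (y \<bullet> e) \<partial>lborel) = (\<integral>y. k (- y) * G (- y \<bullet> e) \<partial>lborel)"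
    by (rule lborel_integral_reflect[symmetric]) measurable
  have "G z + G (- z) = 0" for z
    using profile_shift_antisymmetric[OF T m(2), of z] by (simp add: G_def \<psi>_def N_def)
  then have "G (- z) = - G z" for z by (metis add_eq_0_iff)
  then have "(\<integral>y. k (- y) * G (- y \<bullet> e) \<partial>lborel) = - (\<integral>y. k y * G (y \<bullet> e) \<partial>lborel)"
    by (simp add: k_def)
  with 1 2 show "integral\<^sup>L N a = 0" by simp
qed

text \<open>\<open>e\<close> points from the closest point of \<open>C\<close> to \<open>x\<close>.
  By convexity \<open>C\<close> lies in the half-space behind that closest point, and the signed
  distance to this half-space bounds the distance to \<open>C\<close> from below.\<close>

lemma infdist_supporting_direction:
  fixes C :: "'a::euclidean_space set"
  assumes C: "closed C" "convex C" "C \<noteq> {}" and x: "x \<notin> C"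
  obtains e where "norm e = 1" "\<And>y. infdist x C + (y - x) \<bullet> e \<le> infdist y C"
proof
  define P where "P = closest_point C x"
  define e where "e = (x - P) /\<^sub>R norm (x - P)"
  have P: "P \<in> C" unfolding P_def by (rule closest_point_in_set) (use C in auto)
  then have ne: "norm (x - P) > 0" using x by auto
  then show e: "norm e = 1" by (simp add: e_def)
  have d: "infdist x C = norm (x - P)"
    using setdist_closest_point[OF C(1,3)] by (simp add: infdist_eq_setdist P_def dist_norm)
  have xe: "(x - P) \<bullet> e = norm (x - P)"
    using ne by (simp add: e_def dot_square_norm power2_eq_square)
  show "infdist x C + (y - x) \<bullet> e \<le> infdist y C" for y
    unfolding infdist_notempty[OF C(3)]
  proof (rule cINF_greatest[OF C(3)])
    fix c assume c: "c \<in> C"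
    have "(x - P) \<bullet> (c - P) \<le> 0" unfolding P_def by (rule closest_point_dot) (use C c in auto)
    then have "e \<bullet> (c - P) \<le> 0" using ne by (simp add: e_def divide_le_0_iff mult_le_0_iff)
    moreover have "(y - c) \<bullet> e = (y - x) \<bullet> e + (x - P) \<bullet> e - e \<bullet> (c - P)"
      by (simp add: inner_diff_left inner_diff_right inner_commute)
    moreover have "(y - c) \<bullet> e \<le> dist y c"
      using norm_cauchy_schwarz[of "y - c" e] e by (simp add: dist_norm)
    ultimately show "(INF a\<in>C. dist x a) + (y - x) \<bullet> e \<le> dist y c"
      using d xe infdist_notempty[OF C(3), of x] by simp
  qed
qed

text \<open>The setting to be contradicted: \<open>C\<close> is the set from which distances are
  measured, and \<open>m\<close>, the infimum of \<open>u\<close> off \<open>C\<close>, lies below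
  the limit 1. \<open>B\<close> bounds the gradient and \<open>M\<close> is its Hoelder
  constant.\<close>

locale exterior_supersolution =
  fixes K C :: "'a::euclidean_space set" and u :: "'a \<Rightarrow> real" and Du :: "'a \<Rightarrow> 'a"
    and s p \<beta> M B m :: real
  assumes K: "closed K" "K \<subseteq> C" and C: "closed C" "convex C" "C \<noteq> {}"
    and s: "0 < s" "s < 1" and p: "p = DIM('a) + 2 * s" and \<beta>: "2 * s - 1 < \<beta>" "0 \<le> \<beta>"
    and M: "0 \<le> M" and B: "0 < B"
    and D: "x \<notin> K \<Longrightarrow> GDERIV u x :> Du x"
    and DB: "x \<notin> K \<Longrightarrow> norm (Du x) \<le> B"
    and DM: "\<lbrakk>x \<notin> K; y \<notin> K\<rbrakk> \<Longrightarrow> norm (Du x - Du y) \<le> M * norm (x - y) powr \<beta>"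
    and u1: "x \<notin> K \<Longrightarrow> u x \<le> 1" and lim: "(u \<longlongrightarrow> 1) at_infinity"
    and m: "0 \<le> m" "m < 1" and mu: "x \<notin> K \<Longrightarrow> m \<le> u x"
    and m_inf: "m < v \<Longrightarrow> \<exists>x. x \<notin> C \<and> u x < v"
begin

section \<open>Distance, outward directions and farthest points\<close>

abbreviation "d x \<equiv> infdist x C"

lemma notin_K: "x \<notin> C \<Longrightarrow> x \<notin> K" using K by auto

lemma d_pos: "x \<notin> C \<longleftrightarrow> 0 < d x"
  using infdist_pos_not_in_closed[OF C(1,3)] infdist_zero[of x C] by (metis less_irrefl)

definition dir :: "'a \<Rightarrow> 'a" where
  "dir x = (SOME e. norm e = 1 \<and> (\<forall>y. d x + (y - x) \<bullet> e \<le> d y))"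

lemma dir:
  assumes "x \<notin> C"
  shows "norm (dir x) = 1" "d x + (y - x) \<bullet> dir x \<le> d y"
proof -
  have "\<exists>e. norm e = 1 \<and> (\<forall>y. d x + (y - x) \<bullet> e \<le> d y)"
    by (rule infdist_supporting_direction[OF C assms]) blast
  then have "norm (dir x) = 1 \<and> (\<forall>y. d x + (y - x) \<bullet> dir x \<le> d y)"
    unfolding dir_def by (rule someI_ex)
  then show "norm (dir x) = 1" "d x + (y - x) \<bullet> dir x \<le> d y" by auto
qed

lemma d_dir: "x \<notin> C \<Longrightarrow> d x + h \<le> d (x + h *\<^sub>R dir x)"
  using dir(1)[of x] dir(2)[of x "x + h *\<^sub>R dir x"] by (simp add: norm_eq_1)

lemma dir_notin: "\<lbrakk>x \<notin> C; - d x < h\<rbrakk> \<Longrightarrow> x + h *\<^sub>R dir x \<notin> C"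
  using d_dir[of x h] d_pos by fastforce

text \<open>The ray leaving \<open>x\<close> along \<open>dir x\<close> never meets
  \<open>C\<close>, so the gradient bound holds along the whole segment.\<close>

lemma u_dir:
  assumes "x \<notin> C" "0 \<le> h"
  shows "u (x + h *\<^sub>R dir x) \<le> u x + B * h"
proof -
  have "u (x + h *\<^sub>R dir x) \<le> u x + B * norm (h *\<^sub>R dir x)"
  proof (rule gderiv_lipschitz_bound[where S = "- K" and Du = Du])
    show "x + \<tau> *\<^sub>R h *\<^sub>R dir x \<in> - K" if "0 \<le> \<tau>" for \<tau>
    proof -
      have "- d x < \<tau> * h" using that assms d_pos[of x] mult_nonneg_nonneg[of \<tau> h] by linarith
      then show ?thesis using dir_notin[OF assms(1), of "\<tau> * h"] notin_K by simp
    qed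
  qed (use D DB in auto)
  then show ?thesis using dir(1)[OF assms(1)] assms(2) by simp
qed

lemma u_continuous: "continuous_on (- K) u"
proof -
  have "isCont u x" if "x \<in> - K" for x
    using D[of x] that unfolding gderiv_def by (auto intro: has_derivative_continuous)
  then show ?thesis by (simp add: continuous_at_imp_continuous_on)
qed

definition farthest :: "real \<Rightarrow> 'a \<Rightarrow> bool" where
  "farthest v x \<longleftrightarrow> x \<notin> C \<and> u x \<le> v \<and> (\<forall>y. y \<notin> C \<and> u y \<le> v \<longrightarrow> d y \<le> d x)"

text \<open>As \<open>u\<close> tends to 1, the points with \<open>u x \<le> v\<close> are bounded;
  away from \<open>C\<close> they form a closed set, so the distance attains its maximum by
  compactness.\<close>

lemma farthest_exists:
  assumes v: "v \<in> {m<..<1}"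
  shows "\<exists>x. farthest v x"
proof -
  obtain x1 where x1: "x1 \<notin> C" "u x1 < v" using m_inf[of v] v by auto
  have "eventually (\<lambda>x. v < u x) at_infinity"
    using v by (intro order_tendstoD[OF lim]) auto
  then obtain b where b: "\<And>x. b \<le> norm x \<Longrightarrow> v < u x"
    by (auto simp: eventually_at_infinity)
  \<comment> \<open>The condition \<open>d x1 \<le> d x\<close> keeps the set off \<open>C\<close>,
    where \<open>u\<close> is continuous; no maximiser is lost, because \<open>x1\<close> itself
    competes.\<close>
  define A where "A = cball 0 b \<inter> {x. d x1 \<le> d x}"
  have A: "closed A" unfolding A_def
    by (intro closed_Int closed_cball closed_Collect_le continuous_intros)
  have AC: "x \<notin> C" if "x \<in> A" for x
    using that x1(1) d_pos[of x] d_pos[of x1] by (auto simp: A_def)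
  then have "A \<subseteq> - K" using K(2) by blast
  define S where "S = {x \<in> A. u x \<le> v}"
  have "closed S" unfolding S_def
    by (intro continuous_on_closed_Collect_le continuous_on_const continuous_on_subset[OF u_continuous] A \<open>A \<subseteq> - K\<close>)
  moreover have "S \<subseteq> cball 0 b" by (auto simp: S_def A_def)
  ultimately have "compact S" by (meson bounded_cball bounded_subset compact_eq_bounded_closed)
  moreover have "x1 \<in> S"
  proof -
    have "norm x1 \<le> b" by (rule ccontr) (use b[of x1] x1 in auto)
    then show ?thesis using x1 by (auto simp: S_def A_def)
  qed
  ultimately obtain x where x: "x \<in> S" "\<And>y. y \<in> S \<Longrightarrow> d y \<le> d x"
    using continuous_attains_sup[of S d, OF _ _ continuous_on_infdist[OF continuous_on_id]] by blast
  have "farthest v x"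
    unfolding farthest_def
  proof (intro conjI allI impI)
    show "x \<notin> C" "u x \<le> v" using x(1) AC by (auto simp: S_def)
    fix y assume y: "y \<notin> C \<and> u y \<le> v"
    show "d y \<le> d x"
    proof (cases "d x1 \<le> d y")
      case True
      have "norm y \<le> b" by (rule ccontr) (use b[of y] y in auto)
      then have "y \<in> S" using y True by (auto simp: S_def A_def)
      then show ?thesis by (rule x(2))
    next
      case False
      then show ?thesis using x(2)[OF \<open>x1 \<in> S\<close>] by linarith
    qed
  qed
  then show ?thesis ..
qed

definition pt :: "real \<Rightarrow> 'a" where "pt v = (SOME x. farthest v x)"
definition T :: "real \<Rightarrow> real" where "T v = d (pt v)"

lemma pt:
  assumes v: "v \<in> {m<..<1}"
  shows "farthest v (pt v)" "pt v \<notin> C" "pt v \<notin> K" "u (pt v) \<le> v" "0 < T v"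
    "\<And>y. \<lbrakk>y \<notin> C; u y \<le> v\<rbrakk> \<Longrightarrow> d y \<le> T v"
proof -
  show f: "farthest v (pt v)" unfolding pt_def by (rule someI_ex[OF farthest_exists[OF v]])
  then show "pt v \<notin> C" "pt v \<notin> K" "u (pt v) \<le> v" "0 < T v" "\<And>y. \<lbrakk>y \<notin> C; u y \<le> v\<rbrakk> \<Longrightarrow> d y \<le> T v"
    using d_pos notin_K by (auto simp: farthest_def T_def)
qed

text \<open>If \<open>u x < v\<close>, the gradient bound allows a further step of length
  \<open>(v - u x) / B\<close> along \<open>dir x\<close> without leaving the sublevel set, which
  increases the distance.\<close>

lemma farthest_level:
  assumes "farthest v x"
  shows "u x = v"
proof (rule ccontr)
  assume "u x \<noteq> v"
  with assms have x: "x \<notin> C" "u x < v" and far: "\<And>y. \<lbrakk>y \<notin> C; u y \<le> v\<rbrakk> \<Longrightarrow> d y \<le> d x"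
    by (auto simp: farthest_def)
  define h where "h = (v - u x) / B"
  have h: "0 < h" using x B by (simp add: h_def)
  have "u (x + h *\<^sub>R dir x) \<le> u x + B * h" using x h by (intro u_dir) auto
  also have "\<dots> = v" using B by (simp add: h_def)
  finally have "u (x + h *\<^sub>R dir x) \<le> v" .
  moreover have "x + h *\<^sub>R dir x \<notin> C" using dir_notin[OF x(1)] h d_pos[of x] x(1) by simp
  ultimately show False using far[of "x + h *\<^sub>R dir x"] d_dir[OF x(1), of h] h by linarith
qed

text \<open>If \<open>T v = T w\<close> with \<open>v < w\<close>, then \<open>pt v\<close> is also
  farthest for \<open>w\<close>, so \<open>u\<close> would equal \<open>w\<close> there although it
  is at most \<open>v\<close>.\<close>

lemma T_strict_mono: "strict_mono_on {m<..<1} T"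
proof (rule strict_mono_onI)
  fix v w assume vw: "v \<in> {m<..<1}" "w \<in> {m<..<1}" "v < w"
  note v = pt[OF vw(1)] and w = pt[OF vw(2)]
  have "T v \<le> T w" using w(6)[of "pt v"] v vw(3) unfolding T_def by simp
  moreover have "T v \<noteq> T w"
  proof
    assume "T v = T w"
    then have "farthest w (pt v)"
      using v w(6) vw(3) unfolding farthest_def T_def by auto
    then show False using farthest_level[of w "pt v"] v(4) vw(3) by simp
  qed
  ultimately show "T v < T w" by simp
qed

text \<open>Starting where \<open>u\<close> is almost \<open>m\<close> and walking outward,
  \<open>u\<close> grows at rate at most \<open>B\<close> and so stays below \<open>v\<close> for a
  length of nearly \<open>(v - m) / B\<close>.\<close>

lemma T_lower_bound:
  assumes v: "v \<in> {m<..<1}"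
  shows "(v - m) / B \<le> T v"
proof (rule field_le_epsilon)
  fix \<epsilon> :: real assume \<epsilon>: "0 < \<epsilon>"
  show "(v - m) / B \<le> T v + \<epsilon>"
  proof (cases "v - m \<le> B * \<epsilon>")
    case True
    then have "(v - m) / B \<le> \<epsilon>" using B by (simp add: divide_le_eq mult.commute)
    then show ?thesis using pt(5)[OF v] by linarith
  next
    case False
    have "m < m + B * \<epsilon>" using B \<epsilon> by simp
    then obtain x where x: "x \<notin> C" "u x < m + B * \<epsilon>" using m_inf by blast
    define h where "h = (v - m) / B - \<epsilon>"
    have "\<epsilon> < (v - m) / B" using False B by (simp add: less_divide_eq mult.commute)
    then have h: "0 < h" by (simp add: h_def)
    have Bh: "B * h = v - m - B * \<epsilon>" using B by (simp add: h_def field_simps)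
    have "u (x + h *\<^sub>R dir x) \<le> u x + B * h" using x h by (intro u_dir) auto
    also have "\<dots> \<le> v" using Bh x by simp
    finally have "u (x + h *\<^sub>R dir x) \<le> v" .
    moreover have "x + h *\<^sub>R dir x \<notin> C" using dir_notin[OF x(1)] h d_pos[of x] x(1) by simp
    ultimately have "h \<le> T v"
      using pt(6)[OF v, of "x + h *\<^sub>R dir x"] d_dir[OF x(1), of h] x(1) d_pos[of x] by linarith
    then show ?thesis by (simp add: h_def)
  qed
qed

section \<open>Comparison with the planar profile\<close>

definition N :: "real measure" where "N = restrict_space lborel {m<..<1}"
text \<open>By monotonicity of \<open>T\<close> the levels \<open>w\<close> with
  \<open>T w < t\<close> form an interval starting at \<open>m\<close>, so \<open>\<psi> t\<close>
  is its right end. Writing this as a measure also covers jumps of \<open>T\<close> and prepares for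
  Fubini.\<close>

definition \<psi> :: "real \<Rightarrow> real" where "\<psi> t = m + measure N {w \<in> space N. T w < t}"

lemma space_N: "space N = {m<..<1}"
  by (simp add: N_def space_restrict_space)

lemma measure_N: "A \<subseteq> {m<..<1} \<Longrightarrow> measure N A = measure lborel A"
  by (simp add: N_def measure_restrict_space)

lemma emeasure_N: "emeasure N (space N) = ennreal (1 - m)"
  using m by (simp add: space_N) (simp add: N_def emeasure_restrict_space)

sublocale N: finite_measure N
  by (rule finite_measureI) (simp add: emeasure_N)

lemma T_measurable [measurable]: "T \<in> borel_measurable N"
  using borel_measurable_mono_on_fnc[of "{m<..<1}" T] strict_mono_on_imp_mono_on[OF T_strict_mono]
  by (simp add: N_def cong: measurable_cong_sets)

lemma \<psi>_mono: "t \<le> t' \<Longrightarrow> \<psi> t \<le> \<psi> t'"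
  unfolding \<psi>_def by (intro add_left_mono N.finite_measure_mono) auto

lemma \<psi>_measurable [measurable]: "\<psi> \<in> borel_measurable borel"
  by (intro borel_measurable_mono monoI \<psi>_mono)

lemma \<psi>_bounds: "m \<le> \<psi> t" "\<psi> t \<le> 1"
  using N.bounded_measure[of "{w \<in> space N. T w < t}"] emeasure_N m
  by (auto simp: \<psi>_def measure_def)

lemma \<psi>_nonpos:
  assumes "t \<le> 0"
  shows "\<psi> t = m"
proof -
  have "{w \<in> space N. T w < t} = {}" using assms pt(5) by (fastforce simp: space_N)
  then show ?thesis unfolding \<psi>_def by (simp only: measure_empty add_0_right)
qed

text \<open>Any level \<open>w\<close> with \<open>T w < d y\<close> must satisfy
  \<open>w < u y\<close>: otherwise \<open>y\<close> would lie in the sublevel set of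
  \<open>w\<close>, farther away than its farthest point.\<close>

lemma \<psi>_d_le:
  assumes y: "y \<notin> C"
  shows "\<psi> (d y) \<le> u y"
proof -
  have y1: "m \<le> u y" "u y \<le> 1" using mu u1 notin_K[OF y] by auto
  have "w < u y" if "w \<in> {m<..<1}" "T w < d y" for w
    by (rule ccontr) (use pt(6)[OF that(1) y] that in auto)
  then have sub: "{w \<in> space N. T w < d y} \<subseteq> {m<..<u y}" by (auto simp: space_N)
  have "{m<..<u y} \<in> sets N"
    using y1 by (auto simp: N_def sets_restrict_space_iff)
  then have "measure N {w \<in> space N. T w < d y} \<le> measure N {m<..<u y}"
    by (rule N.finite_measure_mono[OF sub])
  also have "\<dots> = u y - m" using y1 by (subst measure_N) auto
  finally show ?thesis by (simp add: \<psi>_def)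
qed

lemma pt_level: "v \<in> {m<..<1} \<Longrightarrow> u (pt v) = v"
  using pt(1) farthest_level by blast

text \<open>The planar argument is at most \<open>d y\<close> and \<open>\<psi>\<close> is monotone,
  so the bound by \<open>\<psi> (d y)\<close> applies off \<open>C\<close>; on \<open>C\<close> the
  argument is nonpositive and the value is \<open>m\<close>.\<close>

lemma \<psi>_le:
  assumes v: "v \<in> {m<..<1}" and y: "y \<notin> K"
  shows "\<psi> (T v + (y - pt v) \<bullet> dir (pt v)) \<le> u y"
proof -
  have le: "T v + (y - pt v) \<bullet> dir (pt v) \<le> d y"
    unfolding T_def by (rule dir(2)[OF pt(2)[OF v]])
  show ?thesis
  proof (cases "y \<in> C")
    case True
    then show ?thesis using \<psi>_nonpos le mu[OF y] by simp
  next
    case False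
    then show ?thesis using \<psi>_mono[OF le] \<psi>_d_le[of y] by linarith
  qed
qed

lemma \<psi>_in_K:
  assumes v: "v \<in> {m<..<1}" and y: "y \<in> K"
  shows "\<psi> (T v + (y - pt v) \<bullet> dir (pt v)) = m"
proof -
  have "T v + (y - pt v) \<bullet> dir (pt v) \<le> d y"
    unfolding T_def by (rule dir(2)[OF pt(2)[OF v]])
  then show ?thesis using \<psi>_nonpos y K(2) by (simp add: subset_iff)
qed

section \<open>Truncated operators on \<open>u\<close> and on the profile\<close>

definition trunc_op :: "real \<Rightarrow> 'a \<Rightarrow> real" where
  "trunc_op \<delta> x = (LINT y:{y. y \<notin> K \<and> norm (x - y) > \<delta>}|lborel. (u y - u x) / norm (x - y) powr p)"

lemma u_ind_measurable [measurable]: "(\<lambda>y. indicator (- K) y * u y) \<in> borel_measurable borel"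
  using borel_measurable_continuous_on_indicator[OF _ u_continuous] K(1) by simp

lemma K_measurable [measurable]: "K \<in> sets borel"
  using K(1) by (rule borel_closed)

lemma increment_measurable [measurable]:
  "(\<lambda>y. indicator (- K) (x + y) * (u (x + y) - c)) \<in> borel_measurable borel"
proof -
  have "(\<lambda>y. indicator (- K) (x + y) * u (x + y) - c * indicator (- K) (x + y)) \<in> borel_measurable borel"
    using measurable_compose[OF _ u_ind_measurable, of "\<lambda>y. x + y" borel] by measurable
  then show ?thesis by (simp add: algebra_simps)
qed

lemma increment_bounded: "x \<notin> K \<Longrightarrow> \<bar>indicator (- K) y * (u y - u x)\<bar> \<le> 1"
  using mu[of x] mu[of y] u1[of x] u1[of y] m by (auto simp: indicator_def)

lemma trunc_op_kernel:
  "trunc_op \<delta> x = (\<integral>y. trunc_kernel p \<delta> y * (indicator (- K) (x + y) * (u (x + y) - u x)) \<partial>lborel)"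
  unfolding trunc_op_def
  using set_lebesgue_integral_trunc_kernel[OF u_ind_measurable, where x = x and \<delta> = \<delta> and c = "u x" and p = p] by simp

text \<open>Shows that \<open>Lim\<close> is a genuine limit here: on a ball off \<open>K\<close>
  second differences are of order \<open>1 + \<beta> > 2 * s\<close>.\<close>

lemma trunc_op_converges:
  assumes x: "x \<notin> K"
  shows "((\<lambda>\<delta>. trunc_op \<delta> x) \<longlongrightarrow> Lim (at_right 0) (\<lambda>\<delta>. trunc_op \<delta> x)) (at_right 0)"
proof -
  obtain r where r: "0 < r" "ball x r \<subseteq> - K"
    using x K(1) by (metis ComplI open_Compl open_contains_ball)
  have "\<exists>L. ((\<lambda>\<delta>. \<integral>y. trunc_kernel p \<delta> y * (indicator (- K) (x + y) * (u (x + y) - u x)) \<partial>lborel) \<longlongrightarrow> L) (at_right 0)"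
  proof (rule trunc_integral_converges[where \<rho> = "min r 1" and q = "1 + \<beta>" and M = "2 * M" and c = 1])
    fix y :: 'a assume y: "norm y < min r 1"
    have S: "x + \<tau> *\<^sub>R y \<in> - K" if "\<bar>\<tau>\<bar> \<le> 1" for \<tau>
    proof -
      have "norm (\<tau> *\<^sub>R y) < r" using y that mult_left_le_one_le[of "norm y" "\<bar>\<tau>\<bar>"] by simp
      then have "x + \<tau> *\<^sub>R y \<in> ball x r" by (simp add: dist_norm)
      then show ?thesis using r by blast
    qed
    have "\<bar>u (x + y) + u (x - y) - 2 * u x\<bar> \<le> 2 * M * norm y powr (1 + \<beta>)"
      by (rule gderiv_second_difference_bound[where S = "- K"]) (use S D DM M \<beta> in auto)
    moreover have "x + y \<notin> K" "x - y \<notin> K" using S[of 1] S[of "- 1"] by auto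
    ultimately show "\<bar>indicator (- K) (x + y) * (u (x + y) - u x) + indicator (- K) (x + - y) * (u (x + - y) - u x)\<bar>
        \<le> 2 * M * norm y powr (1 + \<beta>)" by (simp add: algebra_simps)
  qed (use r s p \<beta> increment_bounded[OF x] in auto)
  then obtain L where "((\<lambda>\<delta>. trunc_op \<delta> x) \<longlongrightarrow> L) (at_right 0)"
    unfolding trunc_op_kernel by blast
  then show ?thesis using tendsto_Lim[OF trivial_limit_at_right_real] by metis
qed

text \<open>The truncated operator on the whole space, applied to \<open>\<psi>\<close> as a
  function of the coordinate along \<open>e\<close>, at a point where this coordinate is
  \<open>T v\<close>; the subtracted \<open>v\<close> is the value of \<open>\<psi>\<close>
  there.\<close>

definition profile_op :: "real \<Rightarrow> 'a \<Rightarrow> real \<Rightarrow> real" where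
  "profile_op \<delta> e v = (\<integral>y. trunc_kernel p \<delta> y * (\<psi> (T v + y \<bullet> e) - v) \<partial>lborel)"

lemma p_gt: "real DIM('a) < p" using s p by simp

text \<open>Once \<open>e\<close> is rotated to \<open>dir (pt v)\<close>, the integrands compare
  pointwise: off \<open>K\<close> by \<open>\<psi>_le\<close>, and on \<open>K\<close> because the
  planar increment \<open>m - v\<close> is negative while the regional one is zero.\<close>

lemma profile_op_le_trunc_op:
  assumes v: "v \<in> {m<..<1}" and "0 < \<delta>" "norm e = 1"
  shows "profile_op \<delta> e v \<le> trunc_op \<delta> (pt v)"
proof -
  define h where "h r z = (if \<delta> < r then r powr (- p) else 0) * (\<psi> (T v + z) - v)" for r z
  have hk: "h (norm y) (y \<bullet> e) = trunc_kernel p \<delta> y * (\<psi> (T v + y \<bullet> e) - v)" for y e :: 'a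
    by (simp add: h_def trunc_kernel_def)
  have [measurable]: "case_prod h \<in> borel_measurable (borel \<Otimes>\<^sub>M borel)"
    unfolding h_def by measurable
  have "profile_op \<delta> e v = (\<integral>y. trunc_kernel p \<delta> y * (\<psi> (T v + y \<bullet> dir (pt v)) - v) \<partial>lborel)"
    unfolding profile_op_def hk[symmetric]
    using assms(3) dir(1)[OF pt(2)[OF v]] by (intro lborel_integral_inner_rotate) auto
  also have "\<dots> \<le> trunc_op \<delta> (pt v)"
    unfolding trunc_op_kernel
  proof (rule integral_mono)
    show "integrable lborel (\<lambda>y. trunc_kernel p \<delta> y * (\<psi> (T v + y \<bullet> dir (pt v)) - v))"
    proof (rule integrable_bounded_mult[OF integrable_trunc_kernel[OF p_gt \<open>0 < \<delta>\<close>], where c = 1])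
      show "\<bar>\<psi> (T v + y \<bullet> dir (pt v)) - v\<bar> \<le> 1" for y
        using \<psi>_bounds[of "T v + y \<bullet> dir (pt v)"] v m by auto
    qed measurable
    show "integrable lborel (\<lambda>y. trunc_kernel p \<delta> y * (indicator (- K) (pt v + y) * (u (pt v + y) - u (pt v))))"
      by (rule integrable_bounded_mult[OF integrable_trunc_kernel[OF p_gt \<open>0 < \<delta>\<close>] _ increment_bounded[OF pt(3)[OF v]]])
        measurable
    fix y
    have "\<psi> (T v + y \<bullet> dir (pt v)) - v \<le> indicator (- K) (pt v + y) * (u (pt v + y) - u (pt v))"
      using \<psi>_le[OF v, of "pt v + y"] \<psi>_in_K[OF v, of "pt v + y"] v pt_level[OF v]
      by (cases "pt v + y \<in> K") auto
    then show "trunc_kernel p \<delta> y * (\<psi> (T v + y \<bullet> dir (pt v)) - v)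
        \<le> trunc_kernel p \<delta> y * (indicator (- K) (pt v + y) * (u (pt v + y) - u (pt v)))"
      by (intro mult_left_mono) auto
  qed
  finally show ?thesis .
qed

text \<open>The singularity at the bottom level \<open>v = m\<close> is integrable because \<open>s < 1\<close>.\<close>

lemma profile_op_bound:
  obtains c1 c2 where "\<And>v \<delta> e. \<lbrakk>v \<in> {m<..<1}; 0 < \<delta>; norm e = 1\<rbrakk>
    \<Longrightarrow> profile_op \<delta> e v \<le> c1 + c2 * ((v - m) / B) powr (- s)"
proof -
  define c1 where "c1 = M * (\<integral>y. indicator (cball 0 1) y * norm y powr (1 + \<beta> - p) \<partial>(lborel :: 'a measure))
     + (\<integral>y. trunc_kernel p 1 y \<partial>(lborel :: 'a measure))"
  define c2 where "c2 = B * (\<integral>y. indicator (cball 0 1) y * norm y powr (1 - s - DIM('a)) \<partial>(lborel :: 'a measure))"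
  have c2: "0 \<le> c2" unfolding c2_def using B by (intro mult_nonneg_nonneg Bochner_Integration.integral_nonneg) auto
  have "profile_op \<delta> e v \<le> c1 + c2 * ((v - m) / B) powr (- s)"
    if v: "v \<in> {m<..<1}" and \<delta>: "0 < \<delta>" and e: "norm e = 1" for v \<delta> e
  proof -
    define x where "x = pt v"
    have x: "x \<notin> C" "u x = v" "T v = d x" and xK: "x \<notin> K" and T0: "0 < T v"
      using pt[OF v] pt_level[OF v] by (simp_all add: x_def T_def)
    define h where "h z = \<psi> (T v + z) - v" for z
    \<comment> \<open>Restricted to the line through \<open>x\<close> along \<open>dir x\<close>,
      the profile is compared with \<open>u\<close>; the line stays off \<open>C\<close> as long as
      \<open>- T v < z\<close>.\<close>
    have hu: "h z \<le> u (x + z *\<^sub>R dir x) - v" if "- T v < z" for z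
      using \<psi>_le[OF v, of "x + z *\<^sub>R dir x"] dir_notin[OF x(1), of z] dir(1)[OF x(1)] that x(3) notin_K
      by (simp add: h_def x_def norm_eq_1)
    have "profile_op \<delta> e v \<le> M * (\<integral>y. indicator (cball 0 1) y * norm y powr (1 + \<beta> - p) \<partial>(lborel :: 'a measure))
      + B * (\<integral>y. indicator (cball 0 1) y * norm y powr (1 - s - DIM('a)) \<partial>(lborel :: 'a measure)) * T v powr (- s)
      + (\<integral>y. trunc_kernel p 1 y \<partial>(lborel :: 'a measure))"
      unfolding profile_op_def h_def[symmetric]
    proof (rule trunc_integral_upper_bound)
      show "h \<in> borel_measurable borel" unfolding h_def by measurable
      show "\<bar>h z\<bar> \<le> 1" for z using \<psi>_bounds[of "T v + z"] v m by (auto simp: h_def)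
      \<comment> \<open>Below distance \<open>T v\<close> both points
        \<open>x \<plusminus> z *\<^sub>R dir x\<close> lie off \<open>C\<close>, so the second
        difference of \<open>u\<close> is available.\<close>
      show "h z + h (- z) \<le> 2 * M * z powr (1 + \<beta>)" if z: "0 \<le> z" "z < T v" for z
      proof -
        have "\<bar>u (x + z *\<^sub>R dir x) + u (x - z *\<^sub>R dir x) - 2 * u x\<bar> \<le> 2 * M * norm (z *\<^sub>R dir x) powr (1 + \<beta>)"
        proof (rule gderiv_second_difference_bound[where S = "- K" and Du = Du])
          fix \<tau> :: real assume \<tau>: "\<bar>\<tau>\<bar> \<le> 1"
          have "\<bar>\<tau> * z\<bar> \<le> z" using \<tau> z mult_left_le_one_le[of z "\<bar>\<tau>\<bar>"] by (simp add: abs_mult)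
          then have "- d x < \<tau> * z" using z x(3) by linarith
          then show "x + \<tau> *\<^sub>R z *\<^sub>R dir x \<in> - K"
            using dir_notin[OF x(1), of "\<tau> * z"] notin_K by simp
        qed (use D DM M \<beta> in auto)
        then show ?thesis using hu[of z] hu[of "- z"] z x dir(1)[OF x(1)] T0 by simp
      qed
      \<comment> \<open>Farther out only the outward side is estimated through \<open>u\<close>; on
        the inward side monotonicity gives \<open>h (- z) \<le> 0\<close>.\<close>
      show "h z + h (- z) \<le> B * z" if z: "0 \<le> z" for z
      proof -
        have "h z \<le> B * z" using hu[of z] u_dir[OF x(1) z] x z T0 by linarith
        moreover have "\<psi> (T v + - z) \<le> \<psi> (d x)" using z x(3) by (intro \<psi>_mono) simp
        then have "h (- z) \<le> 0" using \<psi>_d_le[OF x(1)] x(2) by (simp add: h_def)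
        ultimately show ?thesis by linarith
      qed
    qed (use e s p \<beta> M B T0 \<delta> in auto)
    also have "\<dots> = c1 + c2 * T v powr (- s)" by (simp add: c1_def c2_def)
    also have "\<dots> \<le> c1 + c2 * ((v - m) / B) powr (- s)"
      using T_lower_bound[OF v] v B s c2 by (intro add_left_mono mult_left_mono powr_mono2') auto
    finally show ?thesis .
  qed
  then show thesis by (rule that)
qed

section \<open>Integration over the levels\<close>

lemma integrable_N_iff: "integrable N f \<longleftrightarrow> set_integrable lborel {m<..<1} f" for f :: "real \<Rightarrow> real"
  by (simp add: N_def integrable_restrict_space set_integrable_def)

lemma integrable_N_powr: "integrable N (\<lambda>v. ((v - m) / B) powr (- s))"
proof -
  have "(\<lambda>x::real. x powr (- s)) integrable_on {0..1}"
    using s by (intro integrable_on_powr_from_0) auto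
  then have "(\<lambda>x::real. x powr (- s)) absolutely_integrable_on {0..1}"
    by (intro nonnegative_absolutely_integrable_1) auto
  then have "integrable lborel (\<lambda>x. indicator {0..1} x * x powr (- s))"
    by (simp add: set_integrable_def integrable_completion)
  \<comment> \<open>The translation moves the singularity to \<open>m\<close>, and
    \<open>{m..m + 1}\<close> contains all levels because \<open>0 \<le> m\<close>.\<close>
  then have "integrable lborel (\<lambda>x. indicator {0..1} (- m + 1 * x) * (- m + 1 * x) powr (- s))"
    by (rule lborel_integrable_real_affine) simp
  then have "set_integrable lborel {m..m + 1} (\<lambda>v. (v - m) powr (- s))"
    unfolding set_integrable_def
    by (rule Bochner_Integration.integrable_cong[THEN iffD1, rotated -1]) (auto simp: indicator_def)
  then have "set_integrable lborel {m<..<1} (\<lambda>v. (v - m) powr (- s))"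
    by (rule set_integrable_subset) (use m in auto)
  then have "integrable N (\<lambda>v. (v - m) powr (- s) * (1 / B) powr (- s))"
    by (intro integrable_mult_left) (simp add: integrable_N_iff)
  then show ?thesis
    by (rule Bochner_Integration.integrable_cong[THEN iffD1, rotated -1])
      (use B in \<open>auto simp: space_N powr_mult[symmetric]\<close>)
qed

text \<open>At \<open>pt v\<close> the value of \<open>u\<close> is \<open>v\<close>, so the limit
  of the truncated operators there is at most \<open>- f v / c\<close>. They dominate the profile
  operators, whose integrals over the levels vanish, and Fatou's lemma passes to the limit.\<close>

lemma integral_reaction_nonpos:
  fixes f :: "real \<Rightarrow> real"
  assumes f: "continuous_on {0..1} f" and c: "0 < c"
    and super: "\<And>x. x \<notin> K \<Longrightarrow> c * Lim (at_right 0) (\<lambda>\<delta>. trunc_op \<delta> x) + f (u x) \<le> 0"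
  shows "integral {m..1} f \<le> 0"
proof -
  obtain c1 c2 where b: "\<And>v \<delta> e. \<lbrakk>v \<in> {m<..<1}; 0 < \<delta>; norm e = 1\<rbrakk>
      \<Longrightarrow> profile_op \<delta> e v \<le> c1 + c2 * ((v - m) / B) powr (- s)"
    using profile_op_bound by metis
  \<comment> \<open>One direction for all levels; \<open>profile_op_le_trunc_op\<close> allows any
    unit vector.\<close>
  obtain e :: 'a where e: "norm e = 1" using vector_choose_size[of 1] by auto
  have fm: "set_integrable lborel {m..1} f"
    using m by (intro borel_integrable_atLeastAtMost' continuous_on_subset[OF f]) auto
  then have fN: "set_integrable lborel {m<..<1} f"
    by (rule set_integrable_subset) auto
  define \<delta> where "\<delta> n = 1 / real (Suc n)" for n
  have \<delta>: "0 < \<delta> n" for n by (simp add: \<delta>_def)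
  have \<delta>_lim: "filterlim \<delta> (at_right 0) sequentially"
    unfolding \<delta>_def filterlim_at using LIMSEQ_Suc[OF lim_1_over_n] by auto
  have "0 \<le> (\<integral>v. - f v / c \<partial>N)"
  proof (rule Fatou_integral_bound[where a = "\<lambda>n. profile_op (\<delta> n) e" and l = "\<lambda>n v. trunc_op (\<delta> n) (pt v)"
        and g = "\<lambda>v. c1 + c2 * ((v - m) / B) powr (- s)" and L = "\<lambda>v. Lim (at_right 0) (\<lambda>\<delta>. trunc_op \<delta> (pt v))"])
    show "integrable N (profile_op (\<delta> n) e)" "integral\<^sup>L N (profile_op (\<delta> n) e) = 0" for n
      using trunc_profile_integral_zero[OF T_strict_mono m p_gt \<delta>, of n e]
      unfolding profile_op_def[abs_def] \<psi>_def N_def by simp_all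
    show "profile_op (\<delta> n) e v \<le> trunc_op (\<delta> n) (pt v)" if "v \<in> space N" for n v
      using that \<delta> e by (intro profile_op_le_trunc_op) (auto simp: space_N)
    show "(\<lambda>n. trunc_op (\<delta> n) (pt v)) \<longlonglongrightarrow> Lim (at_right 0) (\<lambda>\<delta>. trunc_op \<delta> (pt v))" if "v \<in> space N" for v
      by (rule filterlim_compose[OF trunc_op_converges]) (use pt(3) that space_N \<delta>_lim in auto)
    show "integrable N (\<lambda>v. c1 + c2 * ((v - m) / B) powr (- s))"
      by (intro Bochner_Integration.integrable_add integrable_mult_right integrable_N_powr) simp
    show "profile_op (\<delta> n) e v \<le> c1 + c2 * ((v - m) / B) powr (- s)" if "v \<in> space N" for n v
      using b[OF _ \<delta> e] that by (simp add: space_N)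
    show "integrable N (\<lambda>v. - f v / c)"
      using fN by (simp add: integrable_N_iff[symmetric])
    show "Lim (at_right 0) (\<lambda>\<delta>. trunc_op \<delta> (pt v)) \<le> - f v / c" if "v \<in> space N" for v
    proof -
      have v: "v \<in> {m<..<1}" using that by (simp add: space_N)
      then have "c * Lim (at_right 0) (\<lambda>\<delta>. trunc_op \<delta> (pt v)) \<le> - f v"
        using super[OF pt(3)[OF v]] pt_level[OF v] by simp
      then show ?thesis using c by (intro pos_le_divide_eq[THEN iffD2]) (simp_all add: mult.commute)
    qed
  qed
  then have "(\<integral>v. f v \<partial>N) \<le> 0" using c by (simp add: zero_le_divide_iff divide_le_0_iff)
  moreover have "(\<integral>v. f v \<partial>N) = (LBINT v:{m<..<1}. f v)"
    by (simp add: N_def integral_restrict_space set_lebesgue_integral_def)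
  moreover have "\<dots> = (LBINT v=ereal m..ereal 1. f v)"
    using m by (subst interval_integral_Ioo) auto
  moreover have "\<dots> = integral {m..1} f"
    using m fm by (intro interval_integral_eq_integral) auto
  ultimately show ?thesis by simp
qed

end

section \<open>The Liouville theorem\<close>

lemma frac_laplacian_const_pos:
  assumes "0 < n" "0 < s" "s < 1"
  shows "0 < frac_laplacian_const n s"
proof -
  have "Gamma (- s) \<noteq> 0"
  proof
    assume "Gamma (- s) = 0"
    \<comment> \<open>\<open>Gamma\<close> takes the value 0 exactly at its poles, the nonpositive
      integers, whereas \<open>- s\<close> lies strictly between -1 and 0.\<close>
    then obtain k :: int where k: "- s = of_int k" by (auto simp: Gamma_eq_zero_iff elim: nonpos_Ints_cases)
    then have "real_of_int k < of_int 0" "of_int (- 1) < real_of_int k" using assms by simp_all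
    then show False unfolding of_int_less_iff by simp
  qed
  then show ?thesis
    unfolding frac_laplacian_const_def using assms
    by (intro divide_pos_pos mult_pos_pos) auto
qed

text \<open>For \<open>\<theta> \<le> m\<close> the integrand is positive inside the interval;
  otherwise the removed part over \<open>{0..m}\<close> contributes at most zero.\<close>

lemma bistable_integral_pos:
  fixes f :: "real \<Rightarrow> real"
  assumes f: "continuous_on {0..1} f" and "0 < \<theta>" "\<theta> < 1" "f 0 = 0" "f \<theta> = 0"
    and neg: "\<forall>t\<in>{0<..<\<theta>}. f t < 0" and pos: "\<forall>t\<in>{\<theta><..<1}. f t > 0"
    and int: "integral {0..1} f > 0" and m: "0 \<le> m" "m < 1"
  shows "0 < integral {m..1} f"
proof (cases "\<theta> \<le> m")
  case True
  have "integral {m..1} (\<lambda>_. 0) < integral {m..1} f"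
    using True m pos by (intro integral_less_real continuous_on_const continuous_on_subset[OF f]) auto
  then show ?thesis by simp
next
  case False
  have fi: "f integrable_on {0..1}" by (intro integrable_continuous_interval f)
  then have f0: "f integrable_on {0..m}" by (rule integrable_on_subinterval) (use m in auto)
  have "f t \<le> 0" if "t \<in> {0..m}" for t
  proof (cases "t = 0")
    case False
    then have "t \<in> {0<..<\<theta>}" using that \<open>\<not> \<theta> \<le> m\<close> by auto
    then show ?thesis using neg by (auto intro: less_imp_le)
  qed (use assms(4) in simp)
  then have "integral {0..m} f \<le> integral {0..m} (\<lambda>_. 0)"
    by (intro integral_le f0) auto
  moreover have "integral {0..m} f + integral {m..1} f = integral {0..1} f"
    using m fi by (intro Henstock_Kurzweil_Integration.integral_combine) auto
  ultimately show ?thesis using int by simp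
qed

theorem theorem2p3:
  fixes K :: "(real ^ 'n) set"
    and s \<beta> \<theta> :: real
    and f f' :: "real \<Rightarrow> real"
    and u :: "real ^ 'n \<Rightarrow> real"
    and Du :: "real ^ 'n \<Rightarrow> real ^ 'n"
  assumes "CARD('n) \<ge> 2"
    and "1 / 2 \<le> s" and "s < 1"
    and "compact K" and "convex K" and "lipschitz_boundary K"
    and "\<forall>t\<in>{0..1}. (f has_real_derivative f' t) (at t within {0..1})"
    and "continuous_on {0..1} f'"
    and "0 < \<theta>" and "\<theta> < 1"
    and "f 0 = 0" and "f \<theta> = 0" and "f 1 = 0"
    and "\<forall>t\<in>{0<..<\<theta>}. f t < 0" and "\<forall>t\<in>{\<theta><..<1}. f t > 0"
    and "integral {0..1} f > 0"
    and "f' 0 < 0" and "f' \<theta> > 0" and "f' 1 < 0"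
    and "\<beta> > 2 * s - 1"
    and "C1_holder_on (- K) \<beta> u Du"
    and "\<forall>x\<in>- K. u x \<in> {0..1}"
    and "\<forall>x\<in>- K. regional_frac_laplacian K s u x + f (u x) \<le> 0"
    and "\<forall>p\<in>frontier K. \<forall>\<nu>. outward_unit_normal K p \<nu> \<longrightarrow> Du p \<bullet> \<nu> = 0"
    and "(u \<longlongrightarrow> 1) at_infinity"
  shows "\<forall>x\<in>closure (- K). u x = 1"
proof -
  note s = assms(2,3) and \<beta> = assms(20) and super = assms(23)
  have D: "GDERIV u x :> Du x" if "x \<notin> K" for x
    using assms(21) that by (auto simp: C1_holder_on_def)
  have u_cont: "continuous_on (closure (- K)) u"
    using assms(21) by (auto simp: C1_holder_on_def)
  have u01: "0 \<le> u x" "u x \<le> 1" if "x \<notin> K" for x using assms(22) that by auto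
  obtain B0 where B0: "norm (Du x) \<le> B0" if "x \<notin> K" for x
    using assms(21) unfolding C1_holder_on_def bounded_iff by auto
  obtain M0 where M0: "norm (Du x - Du y) \<le> M0 * norm (x - y) powr \<beta>" if "x \<notin> K" "y \<notin> K" for x y
    using assms(21) unfolding C1_holder_on_def by auto
  have f: "continuous_on {0..1} f"
    unfolding continuous_on_eq_continuous_within using assms(7) by (auto intro: DERIV_continuous)
  \<comment> \<open>For empty \<open>K\<close> the distance to a single point plays the role of the distance to \<open>K\<close>.\<close>
  define C where "C = (if K = {} then {0} else K)"
  have C: "compact C" "convex C" "C \<noteq> {}" "K \<subseteq> C" using assms(4,5) by (auto simp: C_def)
  \<comment> \<open>A single point has empty interior, so removing it leaves the closure
    unchanged.\<close>
  have cl: "closure (- C) = closure (- K)"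
    by (simp add: C_def closure_complement interior_singleton)
  have nC: "- C \<noteq> {}"
  proof -
    have "C \<noteq> UNIV" using C(1) not_compact_UNIV by metis
    then show ?thesis by auto
  qed
  define m where "m = Inf (u ` (- C))"
  have bdd: "bdd_below (u ` (- C))"
    using u01 C(4) by (intro bdd_belowI[of _ 0]) auto
  have mC: "m \<le> u x" if "x \<notin> C" for x
    unfolding m_def using that bdd by (intro cInf_lower) auto
  \<comment> \<open>Continuity extends the lower bound to a point of \<open>C\<close> outside
    \<open>K\<close>, namely the origin when \<open>K\<close> is empty.\<close>
  have mu: "m \<le> u x" if "x \<notin> K" for x
  proof (rule continuous_ge_on_closure[of "- C" u])
    show "continuous_on (closure (- C)) u" using u_cont cl by simp
    show "x \<in> closure (- C)" using that closure_subset[of "- K"] cl by auto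
  qed (use mC in auto)
  have m0: "0 \<le> m" unfolding m_def using nC u01 C(4) by (intro cInf_greatest) auto
  have "\<not> m < 1"
  proof
    assume m1: "m < 1"
    \<comment> \<open>The maxima give the two constants the signs that the locale demands.\<close>
    interpret exterior_supersolution K C u Du s "DIM(real ^ 'n) + 2 * s" \<beta> "max M0 0" "max B0 1" m
    proof
      show "closed K" "closed C" using assms(4) C(1) by (auto intro: compact_imp_closed)
      show "norm (Du x) \<le> max B0 1" if "x \<notin> K" for x using B0[OF that] by simp
      show "norm (Du x - Du y) \<le> max M0 0 * norm (x - y) powr \<beta>" if "x \<notin> K" "y \<notin> K" for x y
        using M0[OF that] by (rule order_trans) (intro mult_right_mono, auto)
      show "\<exists>x. x \<notin> C \<and> u x < v" if "m < v" for v
      proof -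
        have "u ` (- C) \<noteq> {}" using nC by simp
        then obtain z where z: "z \<in> u ` (- C)" "z < v"
          using cInf_lessD \<open>m < v\<close> unfolding m_def by meson
        then obtain x where "x \<in> - C" "z = u x" by (elim imageE)
        then show ?thesis using z(2) by (intro exI[of _ x]) simp
      qed
      \<comment> \<open>As \<open>1 / 2 \<le> s\<close>, the number \<open>2 * s - 1\<close> is
        nonnegative, and \<open>\<beta>\<close> exceeds it.\<close>
      show "0 < s" "0 \<le> \<beta>" using s \<beta> by linarith+
      show "GDERIV u x :> Du x" "u x \<le> 1" "m \<le> u x" if "x \<notin> K" for x
        by (rule D u01 mu; fact that)+
      show "K \<subseteq> C" "convex C" "C \<noteq> {}" "s < 1" "2 * s - 1 < \<beta>" "(u \<longlongrightarrow> 1) at_infinity" "0 \<le> m" "m < 1"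
        by (fact C s \<beta> m0 m1 assms(25))+
      show "DIM(real ^ 'n) + 2 * s = DIM(real ^ 'n) + 2 * s" "0 \<le> max M0 0" "0 < max B0 1" by simp_all
    qed
    have "integral {m..1} f \<le> 0"
    proof (rule integral_reaction_nonpos[OF f frac_laplacian_const_pos])
      show "frac_laplacian_const DIM(real ^ 'n) s * Lim (at_right 0) (\<lambda>\<delta>. trunc_op \<delta> x) + f (u x) \<le> 0"
        if "x \<notin> K" for x
        using super[rule_format, of x] that unfolding regional_frac_laplacian_def trunc_op_def by simp
    qed (use s in auto)
    moreover have "0 < integral {m..1} f"
      by (rule bistable_integral_pos[OF f assms(9-12,14-16) m0 m1])
    ultimately show False by simp
  qed
  have u1: "u x = 1" if "x \<in> - C" for x
  proof (rule antisym)
    show "u x \<le> 1" using that C(4) by (intro u01) blast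
    show "1 \<le> u x" using mC[of x] that \<open>\<not> m < 1\<close> by simp
  qed
  have cont: "continuous_on (closure (- C)) u" using u_cont unfolding cl .
  show ?thesis
    using continuous_constant_on_closure[OF cont u1] unfolding cl by blast
qed

end
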